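(* Assume $B=0$ and $B^*=0$. Then there exist complex scalars $a,b,c,a^*,b^*,c^*,x$ such that one of the following eight cases holds (with the formulas for $\xi_i$ valid for $0\le i\le N-1$ and those for $\theta_i,\theta^*_i$ valid for $0\le i\le N$): (I$^+$) $b\ne0$, $b^*=0$, $c\neq0$, $c^*\neq0$; $\xi_i=x-q^{-1-N-M-i}(q-1)^2cc^*$, $\theta_i=a+bq^i+cq^{-i}$, $\theta^*_i=a^*+c^*q^{-i}$; (I$^-$) $b=0$, $b^*\ne0$, $c\neq0$, $c^*\neq0$; $\xi_i=x-q^{-1-N-M-i}(q-1)^2cc^*$, $\theta_i=a+cq^{-i}$, $\theta^*_i=a^*+b^*q^i+c^*q^{-i}$; (I$^0$) $b=b^*=0$, $c\neq0$, $c^*\neq0$; $\xi_i=x-q^{-1-N-M-i}(q-1)^2cc^*$, $\theta_i=a+cq^{-i}$, $\theta^*_i=a^*+c^*q^{-i}$; (II$^+$) $c\ne0$, $c^*=0$, $b\ne0$, $b^*\ne0$; $\xi_i=x-q^{-1-N-M-i}(q-1)^2bb^*$, $\theta_i=a+bq^{-i}+cq^{i}$, $\theta^*_i=a^*+b^*q^{-i}$; (II$^-$) $c=0$, $c^*\ne0$, $b\ne0$, $b^*\ne0$; $\xi_i=x-q^{-1-N-M-i}(q-1)^2bb^*$, $\theta_i=a+bq^{-i}$, $\theta^*_i=a^*+b^*q^{-i}+c^*q^{i}$; (II$^0$) $c=c^*=0$, $b\ne0$, $b^*\ne0$; $\xi_i=x-q^{-1-N-M-i}(q-1)^2bb^*$,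 $\theta_i=a+bq^{-i}$, $\theta^*_i=a^*+b^*q^{-i}$; (III$^+$) $x\ne0$, $b\neq0$, $b^*=0$, $c=0$, $c^*\neq0$; $\xi_i=x$, $\theta_i=a+bq^i$, $\theta^*_i=a^*+c^*q^{-i}$; (III$^-$) $x\ne0$, $b=0$, $b^*\neq0$, $c\neq0$, $c^*=0$; $\xi_i=x$, $\theta_i=a+cq^{-i}$, $\theta^*_i=a^*+b^*q^{i}$.
   Context: Let $N\ge 6$ and $M\ge1$ be integers, let $\mathbb{F}_q$ be a finite field with $q$ elements. Let $H$ be an $(N+M)$-dimensional vector space over $\mathbb{F}_q$ and fix an $M$-dimensional subspace $h$ of $H$. Let $P$ be the set of subspaces $x$ of $H$ with $x\cap h=0$, partially ordered by inclusion, and for $0\le i\le N$ let $P_i$ be the set of elements of $P$ of dimension $i$. For $x,y\in P$ say $y$ covers $x$ if $x\subsetneq y$ and there is no $z\in P$ with $x\subsetneq z\subsetneq y$. Define $L,R\in\mathrm{Mat}_P(\mathbb{C})$ (complex matrices indexed by $P$) by $L_{xy}=1$ if $y$ covers $x$ and $0$ otherwise, $R_{xy}=1$ if $x$ covers $y$ and $0$ otherwise. For $0\le i\le N$ let $F_i$ be the diagonal matrix with $(F_i)_{yy}=1$ if $y\in P_i$ and $0$ otherwise. Let $A=\sum_{i=0}^{N-1}\alpha_iRF_i+\sum_{i=0}^N\theta_iF_i$ and $A^*=\sum_{i=1}^{N}\alpha^*_iLF_i+\sum_{i=0}^N\theta^*_iF_i$, where $\alpha_i,\alpha^*_i,\theta_i,\theta^*_i$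 are complex scalars with $\alpha_i\ne0$ ($0\le i\le N-1$), $\alpha^*_i\neq0$ ($1\le i\le N$), $\theta_i\ne\theta_j$ and $\theta^*_i\ne\theta^*_j$ for $0\le i\neq j\le N$. Set $\xi_i=\alpha_i\alpha^*_{i+1}$ for $0\le i\le N-1$. Fix complex scalars $\beta,\gamma,\gamma^*,\varrho,\varrho^*$ and define $B=[A,\,A^2A^*-\beta AA^*A+A^*A^2-\gamma(AA^*+A^*A)-\varrho A^*]$ and $B^*=[A^*,\,A^{*2}A-\beta A^*AA^*+AA^{*2}-\gamma^*(A^*A+AA^* )-\varrho^*A]$, where $[r,s]=rs-sr$. *)

theory Defs
  imports Complex_Main "HOL-Library.Cardinality" "HOL-Library.Function_Algebras"
begin

text \<open>
  Matrices with rows and columns indexed by a finite set \<open>I\<close> of elements of type \<open>'i\<close> are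
  functions of two arguments.  Addition, subtraction, zero and finite sums are the pointwise ones of
  \<^theory>\<open>HOL-Library.Function_Algebras\<close>; the pointwise product of that theory is never used, and
  the matrix product below carries the index set.  All concrete matrices vanish outside
  \<open>I \<times> I\<close>, and this is preserved by the operations, so that equality of functions is
  equality of matrices.
\<close>

type_synonym 'i cmat = "'i \<Rightarrow> 'i \<Rightarrow> complex"

definition mat_mult :: "'i cmat \<Rightarrow> 'i set \<Rightarrow> 'i cmat \<Rightarrow> 'i cmat"
    (\<open>(_ \<star>\<^bsub>_\<^esub> _)\<close> [70, 0, 71] 70)
  where "X \<star>\<^bsub>I\<^esub> Y = (\<lambda>x y. \<Sum>z\<in>I. X x z * Y z y)"

definition mat_scale :: "complex \<Rightarrow> 'i cmat \<Rightarrow> 'i cmat"  (infixr \<open>*\<^sub>m\<close> 75)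
  where "k *\<^sub>m X = (\<lambda>x y. k * X x y)"

definition mat_comm :: "'i set \<Rightarrow> 'i cmat \<Rightarrow> 'i cmat \<Rightarrow> 'i cmat"
  where "mat_comm I X Y = X \<star>\<^bsub>I\<^esub> Y - Y \<star>\<^bsub>I\<^esub> X"

text \<open>
  \<open>[X, X\<^sup>2Y - \<beta>XYX + YX\<^sup>2 - \<gamma>(XY + YX) - \<rho>Y]\<close>; both \<open>B\<close> and \<open>B\<^sup>*\<close> have this form,
  the latter with the roles of \<open>A\<close> and \<open>A\<^sup>*\<close> exchanged.
\<close>

definition tridiag_comm ::
    "'i set \<Rightarrow> complex \<Rightarrow> complex \<Rightarrow> complex \<Rightarrow> 'i cmat \<Rightarrow> 'i cmat \<Rightarrow> 'i cmat"
  where "tridiag_comm I \<beta> \<gamma> \<rho> X Y =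
    mat_comm I X
      (X \<star>\<^bsub>I\<^esub> X \<star>\<^bsub>I\<^esub> Y - \<beta> *\<^sub>m (X \<star>\<^bsub>I\<^esub> Y \<star>\<^bsub>I\<^esub> X) + Y \<star>\<^bsub>I\<^esub> X \<star>\<^bsub>I\<^esub> X
        - \<gamma> *\<^sub>m (X \<star>\<^bsub>I\<^esub> Y + Y \<star>\<^bsub>I\<^esub> X) - \<rho> *\<^sub>m Y)"

definition attenuated_space ::
    "('k::field \<Rightarrow> 'v::ab_group_add \<Rightarrow> 'v) \<Rightarrow> 'v set \<Rightarrow> 'v set set"
  where "attenuated_space scale h = {x. module.subspace scale x \<and> x \<inter> h = {0}}"

definition attenuated_level ::
    "('k::field \<Rightarrow> 'v::ab_group_add \<Rightarrow> 'v) \<Rightarrow> 'v set \<Rightarrow> nat \<Rightarrow> 'v set set"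
  where "attenuated_level scale h i =
    {x \<in> attenuated_space scale h. vector_space.dim scale x = i}"

definition covers_in :: "'a set set \<Rightarrow> 'a set \<Rightarrow> 'a set \<Rightarrow> bool"
  where "covers_in P y x \<longleftrightarrow>
    x \<in> P \<and> y \<in> P \<and> x \<subset> y \<and> \<not> (\<exists>z\<in>P. x \<subset> z \<and> z \<subset> y)"

definition lowering_mat :: "'a set set \<Rightarrow> 'a set cmat"
  where "lowering_mat P = (\<lambda>x y. if covers_in P y x then 1 else 0)"

definition raising_mat :: "'a set set \<Rightarrow> 'a set cmat"
  where "raising_mat P = (\<lambda>x y. if covers_in P x y then 1 else 0)"

definition diag_ind_mat :: "'i set \<Rightarrow> 'i cmat"
  where "diag_ind_mat S = (\<lambda>x y. if x = y \<and> y \<in> S then 1 else 0)"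

end

theory Submission
  imports Defs
begin

text \<open>
  Write \<open>R\<close> and \<open>L\<close> for summation over the covers of a point and over the points it covers.
  Graded by dimension, \<open>B\<close> is nontrivial only in degrees \<open>-1\<close> and \<open>2\<close> (and \<open>3\<close>, which is implied).
  Degree \<open>-1\<close> of \<open>B\<close> and degree \<open>1\<close> of \<open>B\<^sup>*\<close> say that \<open>\<theta>\<close> and \<open>\<theta>\<^sup>*\<close> satisfy three-term
  recurrences \<open>t\<^sub>i - \<beta>t\<^sub>i\<^sub>+\<^sub>1 + t\<^sub>i\<^sub>+\<^sub>2 = const\<close>.  Degree \<open>2\<close> is, on level \<open>i\<close> and with
  \<open>D\<^sub>i = (\<theta>\<^sup>*\<^sub>i - \<theta>\<^sup>*\<^sub>i\<^sub>+\<^sub>1)(\<theta>\<^sub>i - \<theta>\<^sub>i\<^sub>+\<^sub>1)\<close>, a linear relation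
  between \<open>R\<^sup>3L\<close>, \<open>R\<^sup>2LR\<close>, \<open>RLR\<^sup>2\<close>, \<open>LR\<^sup>3\<close> and \<open>R\<^sup>2\<close> with coefficients
  \<open>\<xi>\<^sub>i\<^sub>-\<^sub>1\<close>, \<open>-(\<beta>+1)\<xi>\<^sub>i\<close>, \<open>(\<beta>+1)\<xi>\<^sub>i\<^sub>+\<^sub>1\<close>, \<open>-\<xi>\<^sub>i\<^sub>+\<^sub>2\<close> and \<open>(\<beta>+1)(D\<^sub>i\<^sub>+\<^sub>1 - D\<^sub>i)\<close>.

  Its entry at \<open>(z, x)\<close> with \<open>dim z = i + 2\<close>, \<open>dim x = i\<close>, \<open>dim (x \<inter> z) = i - 1\<close> counts flags in \<open>x + z\<close> and
  depends only on \<open>dim ((x + z) \<inter> h) \<in> {0, 1}\<close>, giving two recurrences for \<open>\<xi>\<close>; summing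
  the entries over all \<open>z\<close> gives a formula for \<open>D\<^sub>i\<^sub>+\<^sub>1 - D\<^sub>i\<close>.  The recurrences for \<open>\<xi>\<close> are compatible
  only if \<open>\<beta> = r + 1/r\<close> with \<open>r = q\<close> or \<open>r\<^sup>2 = q\<close>.  In the latter case \<open>D\<^sub>i\<^sub>+\<^sub>1 - D\<^sub>i\<close> would be a
  combination of \<open>q\<^sup>i\<close> and \<open>q\<^sup>-\<^sup>i\<close> equal to a nonzero multiple of \<open>r\<^sup>-\<^sup>3\<^sup>i\<close> for three values of \<open>i\<close>,
  which is impossible.  In the former, comparing the powers of \<open>q\<close> gives \<open>bb\<^sup>* = 0\<close> and the value of
  \<open>\<xi>\<close>.  Cases II are cases I with the letters exchanged and never need to be chosen.
\<close>

section \<open>Subspaces of a finite vector space\<close>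

locale finite_field_space = finite_dimensional_vector_space scale Basis
  for scale :: "'k::{field,finite} \<Rightarrow> 'v::ab_group_add \<Rightarrow> 'v" and Basis
begin

lemma card_span_independent:
  assumes "finite B" "independent B"
  shows "finite (span B) \<and> card (span B) = CARD('k) ^ card B"
  using assms
proof (induction B rule: finite_induct)
  case empty
  then show ?case by simp
next
  case (insert a B)
  have ind: "independent B" and a: "a \<notin> span B"
    using insert.prems insert.hyps by (auto simp: independent_insert)
  let ?f = "\<lambda>(k, v). scale k a + v"
  have img: "span (insert a B) = ?f ` (UNIV \<times> span B)"
  proof (intro equalityI subsetI)
    fix x assume "x \<in> span (insert a B)"
    then obtain k where "x - scale k a \<in> span B" by (auto simp: span_breakdown_eq)
    then show "x \<in> ?f ` (UNIV \<times> span B)"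
      by (intro image_eqI[of _ _ "(k, x - scale k a)"]) auto
  next
    fix x assume "x \<in> ?f ` (UNIV \<times> span B)"
    then obtain k v where "x = scale k a + v" "v \<in> span B" by auto
    then have "x - scale k a \<in> span B" by simp
    then show "x \<in> span (insert a B)" by (auto simp: span_breakdown_eq)
  qed
  have inj: "inj_on ?f (UNIV \<times> span B)"
  proof (rule inj_onI, clarsimp)
    fix k v l w
    assume v: "v \<in> span B" and w: "w \<in> span B" and eq: "scale k a + v = scale l a + w"
    have e: "scale (k - l) a = w - v"
      using eq by (simp add: scale_left_diff_distrib algebra_simps)
    have "k = l"
    proof (rule ccontr)
      assume "k \<noteq> l"
      then have "a = scale (inverse (k - l)) (w - v)"
        unfolding e[symmetric] by simp
      then show False using a v w by (metis span_diff span_scale)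
    qed
    then show "k = l \<and> v = w" using eq by simp
  qed
  have IH: "finite (span B)" "card (span B) = CARD('k) ^ card B"
    using insert.IH[OF ind] by auto
  show ?case
    unfolding img using IH insert.hyps
    by (simp add: card_image[OF inj] card_cartesian_product)
qed

lemma finite_space: "finite (UNIV :: 'v set)"
proof -
  have "finite (span Basis)"
    using card_span_independent[OF finite_Basis independent_Basis] by blast
  then show ?thesis by (simp only: span_Basis)
qed

lemma finite_vectors [simp]: "finite (S :: 'v set)"
  using finite_space by (rule rev_finite_subset) simp

lemma finite_vector_sets [simp]: "finite (S :: 'v set set)"
  by (metis Pow_UNIV finite_Pow_iff finite_space finite_subset subset_UNIV)

lemma card_subspace: "subspace S \<Longrightarrow> card S = CARD('k) ^ dim S"
  by (metis basis_exists card_span_independent finite_vectors span_subspace)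

lemma card_field_gt_1: "CARD('k) > 1"
proof -
  have "card {0, 1 :: 'k} \<le> CARD('k)" by (rule card_mono) auto
  then show ?thesis by simp
qed

lemma dim_less: "subspace S \<Longrightarrow> subspace T \<Longrightarrow> S \<subset> T \<Longrightarrow> dim S < dim T"
  by (metis dim_psubset span_eq_iff)

lemma subspace_eqI: "subspace S \<Longrightarrow> subspace T \<Longrightarrow> S \<subseteq> T \<Longrightarrow> dim T \<le> dim S \<Longrightarrow> S = T"
  by (metis subspace_dim_equal)

lemma dim_span_Un_Int:
  assumes "subspace S" "subspace T"
  shows "dim (span (S \<union> T)) + dim (S \<inter> T) = dim S + dim T"
proof -
  have "span (S \<union> T) = {x + y |x y. x \<in> S \<and> y \<in> T}"
    using assms by (simp add: span_Un span_eq_iff[THEN iffD2])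
  then show ?thesis using dim_sums_Int[OF assms] by simp
qed

lemma dim_insert_Suc: "subspace S \<Longrightarrow> v \<notin> S \<Longrightarrow> dim (insert v S) = Suc (dim S)"
  by (metis Suc_eq_plus1 dim_insert span_eq_iff)

text \<open>The choice \<open>g = h\<close> gives the covers in the poset that lie in
  \<open>w\<close>; \<open>g = {0}\<close> imposes no condition on the subspace \<open>y\<close> and
  serves the hyperplane count.\<close>

definition extensions :: "'v set \<Rightarrow> 'v set \<Rightarrow> 'v set \<Rightarrow> 'v set set"
  where "extensions g w x =
    {y. subspace y \<and> y \<inter> g = {0} \<and> x \<subseteq> y \<and> y \<subseteq> w \<and> dim y = Suc (dim x)}"

text \<open>
  Every vector of \<open>w\<close> outside \<open>x + (w \<inter> g)\<close> generates together with \<open>x\<close> exactly one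
  extension of \<open>x\<close>, and every extension arises from all of its vectors outside \<open>x\<close>.
\<close>

lemma card_extensions_nat:
  assumes x: "subspace x" and w: "subspace w" and g: "subspace g"
    and xg: "x \<inter> g = {0}" and xw: "x \<subseteq> w"
  shows "card (extensions g w x) * (CARD('k) - 1) + CARD('k) ^ dim (w \<inter> g)
      = CARD('k) ^ (dim w - dim x)"
proof -
  let ?q = "CARD('k)"
  define T where "T = span (x \<union> (w \<inter> g))"
  have wg: "subspace (w \<inter> g)" using w g by (rule subspace_inter)
  have T: "subspace T" by (simp add: T_def)
  have Tex: "v \<in> T \<longleftrightarrow> (\<exists>a b. v = a + b \<and> a \<in> x \<and> b \<in> w \<inter> g)" for v
    unfolding T_def span_Un span_eq_iff[THEN iffD2, OF x] span_eq_iff[THEN iffD2, OF wg] by auto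
  have "x \<inter> (w \<inter> g) = {0}" using xg subspace_0[OF w] by auto
  then have dimT: "dim T = dim x + dim (w \<inter> g)"
    using dim_span_Un_Int[OF x wg] by (simp add: T_def)
  have Tw: "T \<subseteq> w" unfolding T_def using xw w by (intro span_minimal) auto
  have xT: "x \<subseteq> T" unfolding T_def by (meson Un_upper1 order_trans span_superset)
  have span_ext: "span (insert v x) = y" if "y \<in> extensions g w x" "v \<in> y - x" for y v
    using that x span_minimal[of "insert v x" y]
    by (intro subspace_eqI) (auto simp: extensions_def dim_insert_Suc)
  have eq: "w - T = (\<Union>y \<in> extensions g w x. y - x)"
  proof (intro equalityI subsetI)
    fix v assume v: "v \<in> w - T"
    then have vx: "v \<notin> x" using xT by auto
    let ?y = "span (insert v x)"
    have "u = 0" if u: "u \<in> ?y" "u \<in> g" for u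
    proof -
      from u(1) obtain k where k: "u - scale k v \<in> x"
        using span_eq_iff[THEN iffD2, OF x] by (auto simp: span_breakdown_eq)
      show ?thesis
      proof (cases "k = 0")
        case True
        then show ?thesis using k u xg by auto
      next
        case False
        have "u \<in> w"
          using u(1) v xw w span_minimal[of "insert v x" w] by auto
        then have "u \<in> T" using Tex subspace_0[OF x] u(2) by (metis IntI add_0)
        moreover have "u - scale k v \<in> T" using k xT by auto
        ultimately have "scale k v \<in> T"
          using subspace_diff[OF T, of u "u - scale k v"] by simp
        then have "scale (inverse k) (scale k v) \<in> T" using T by (rule subspace_scale[rotated])
        then show ?thesis using False v by simp
      qed
    qed
    then have "?y \<inter> g = {0}" using subspace_0[OF g] span_zero by auto
    then have "?y \<in> extensions g w x"
      unfolding extensions_def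
      using x vx xw v w span_minimal[of "insert v x" w]
      by (auto simp: dim_insert_Suc intro: span_base)
    moreover have "v \<in> ?y - x" using vx by (auto intro: span_base)
    ultimately show "v \<in> (\<Union>y \<in> extensions g w x. y - x)" by blast
  next
    fix v assume "v \<in> (\<Union>y \<in> extensions g w x. y - x)"
    then obtain y where y: "subspace y" "y \<inter> g = {0}" "x \<subseteq> y" "y \<subseteq> w" and v: "v \<in> y" "v \<notin> x"
      by (auto simp: extensions_def)
    have "v \<notin> T"
    proof
      assume "v \<in> T"
      then obtain a b where ab: "v = a + b" "a \<in> x" "b \<in> w \<inter> g" using Tex by auto
      then have "b = v - a" by simp
      then have "b \<in> y" using subspace_diff[OF y(1) v(1)] ab(2) y(3) by auto
      then have "b = 0" using ab(3) y(2) by auto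
      then show False using ab v by simp
    qed
    then show "v \<in> w - T" using y v by auto
  qed
  \<comment> \<open>Distinct extensions share no vector outside \<open>x\<close>, since such a
    vector generates both of them over \<open>x\<close>.\<close>
  have "card (w - T) = (\<Sum>y\<in>extensions g w x. card (y - x))"
    unfolding eq by (intro card_UN_disjoint) (simp, simp, use span_ext in blast)
  also have "\<dots> = (\<Sum>y\<in>extensions g w x. ?q ^ Suc (dim x) - ?q ^ dim x)"
    by (intro sum.cong refl) (auto simp: extensions_def card_Diff_subset card_subspace x)
  finally have "card (extensions g w x) * (?q ^ Suc (dim x) - ?q ^ dim x)
      = ?q ^ dim w - ?q ^ dim T"
    by (simp add: card_Diff_subset Tw card_subspace T w)
  moreover have "?q ^ dim T \<le> ?q ^ dim w"
    using card_mono[OF finite_vectors Tw] by (simp add: card_subspace T w)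
  ultimately have "card (extensions g w x) * (?q ^ Suc (dim x) - ?q ^ dim x) + ?q ^ dim T
      = ?q ^ dim w" by simp
  moreover have "?q ^ dim w = ?q ^ dim x * ?q ^ (dim w - dim x)"
    using dim_subset[OF xw] by (simp add: power_add[symmetric])
  moreover have "?q ^ Suc (dim x) - ?q ^ dim x = ?q ^ dim x * (?q - 1)"
    by (simp add: algebra_simps diff_mult_distrib2)
  ultimately have "?q ^ dim x * (card (extensions g w x) * (?q - 1) + ?q ^ dim (w \<inter> g))
      = ?q ^ dim x * ?q ^ (dim w - dim x)"
    unfolding dimT by (simp only: power_add add_mult_distrib2 mult.left_commute)
  then show ?thesis by simp
qed

lemma card_extensions:
  assumes "subspace x" "subspace w" "subspace g" "x \<inter> g = {0}" "x \<subseteq> w"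
  shows "of_nat (card (extensions g w x)) = 
    ((of_nat CARD('k) ^ (dim w - dim x) - of_nat CARD('k) ^ dim (w \<inter> g)) / (of_nat CARD('k) - 1) :: complex)"
proof -
  have "of_nat (card (extensions g w x) * (CARD('k) - 1) + CARD('k) ^ dim (w \<inter> g))
      = (of_nat (CARD('k) ^ (dim w - dim x)) :: complex)"
    by (simp only: card_extensions_nat[OF assms])
  moreover have "(of_nat CARD('k) - 1 :: complex) \<noteq> 0" using card_field_gt_1 by simp
  ultimately show ?thesis
    using card_field_gt_1 by (simp add: of_nat_diff field_simps)
qed

text \<open>Take \<open>z\<close> maximal among the subspaces between \<open>K\<close> and
  \<open>X\<close> that miss \<open>v\<close>. By the exchange property, a vector of
  \<open>X\<close> outside the span of \<open>z\<close> and \<open>v\<close> could be added to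
  \<open>z\<close> without capturing \<open>v\<close>.\<close>

lemma exists_hyperplane:
  assumes X: "subspace X" and K: "subspace K" "K \<subseteq> X" and v: "v \<in> X" "v \<notin> K"
  obtains z where "subspace z" "K \<subseteq> z" "z \<subseteq> X" "v \<notin> z" "Suc (dim z) = dim X"
proof -
  let ?Z = "{z. subspace z \<and> K \<subseteq> z \<and> z \<subseteq> X \<and> v \<notin> z}"
  have "K \<in> ?Z" using K v by simp
  then obtain z where z: "z \<in> ?Z" and zmax: "\<And>z'. z' \<in> ?Z \<Longrightarrow> z \<subseteq> z' \<Longrightarrow> z = z'"
    using finite_has_maximal[of ?Z] by auto
  have "X \<subseteq> span (insert v z)"
  proof (rule ccontr)
    assume "\<not> X \<subseteq> span (insert v z)"
    then obtain u where u: "u \<in> X" "u \<notin> span (insert v z)" by auto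
    have "v \<notin> span (insert u z)"
      using u(2) z in_span_insert[of v u z] span_eq_iff[THEN iffD2, of z] by auto
    then have "span (insert u z) \<in> ?Z"
      using z u(1) X span_superset[of "insert u z"] span_minimal[of "insert u z" X] by auto
    from zmax[OF this] have "u \<in> z" using span_superset[of "insert u z"] by auto
    then show False using u(2) by (auto intro: span_base)
  qed
  then have "X = span (insert v z)"
    using span_minimal[of "insert v z" X] z v X by blast
  then show ?thesis using that z dim_insert_Suc[of z v] by auto
qed

section \<open>Counting the hyperplanes of a subspace\<close>

definition hyperplanes :: "'v set \<Rightarrow> 'v set set"
  where "hyperplanes x = {y. subspace y \<and> y \<subseteq> x \<and> dim x = Suc (dim y)}"

text \<open>Fix one hyperplane \<open>x0\<close>. Every other one meets \<open>x0\<close> in a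
  hyperplane \<open>w\<close> of \<open>x0\<close>, and each \<open>w\<close> lies in q + 1
  subspaces of \<open>x\<close> one dimension larger, one of them \<open>x0\<close>. Hence the count
  for \<open>x\<close> is q times the count for \<open>x0\<close>, plus one.\<close>

lemma card_hyperplanes:
  assumes "subspace x"
  shows "card (hyperplanes x) * (CARD('k) - 1) + 1 = CARD('k) ^ dim x"
  using assms
proof (induction "dim x" arbitrary: x)
  case 0
  then have "hyperplanes x = {}" unfolding hyperplanes_def by (simp del: dim_eq_0)
  then show ?case using 0 by (simp del: dim_eq_0)
next
  case (Suc n)
  let ?q = "CARD('k)"
  from Suc.hyps(2) Suc.prems obtain v where v: "v \<in> x" "v \<noteq> 0"
    by (metis dim_eq_0 nat.simps(3) subsetI singletonI)
  obtain x0 where x0: "subspace x0" "x0 \<subseteq> x" "Suc (dim x0) = dim x"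
    using exists_hyperplane[OF Suc.prems _ _ v(1), of "{0}"] v subspace_0[OF Suc.prems] by auto
  have IH: "card (hyperplanes x0) * (?q - 1) + 1 = ?q ^ n"
    using Suc.hyps x0 by (metis nat.inject)
  have eq: "hyperplanes x - {x0} = (\<Union>w \<in> hyperplanes x0. extensions {0} x w - {x0})"
  proof (intro equalityI subsetI)
    fix y assume "y \<in> hyperplanes x - {x0}"
    then have y: "subspace y" "y \<subseteq> x" "dim x = Suc (dim y)" "y \<noteq> x0"
      by (auto simp: hyperplanes_def)
    have "\<not> x0 \<subseteq> y" using y x0 subspace_eqI[of x0 y] by auto
    then have "y \<subset> span (x0 \<union> y)" using span_superset[of "x0 \<union> y"] by blast
    then have "dim y < dim (span (x0 \<union> y))" by (intro dim_less) (use y in auto)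
    moreover have "span (x0 \<union> y) \<subseteq> x" using x0 y Suc.prems by (intro span_minimal) auto
    then have "dim (span (x0 \<union> y)) \<le> dim x" by (rule dim_subset)
    ultimately have "dim (span (x0 \<union> y)) = dim x" using y by simp
    then have d: "Suc (dim (x0 \<inter> y)) = dim x0"
      using dim_span_Un_Int[OF x0(1) y(1)] y(3) by simp
    then have "x0 \<inter> y \<in> hyperplanes x0"
      using subspace_inter[OF x0(1) y(1)] by (auto simp: hyperplanes_def)
    moreover have "y \<in> extensions {0} x (x0 \<inter> y) - {x0}"
      using y x0 d subspace_0[OF y(1)] by (auto simp: extensions_def)
    ultimately show "y \<in> (\<Union>w \<in> hyperplanes x0. extensions {0} x w - {x0})" by blast
  next
    fix y assume "y \<in> (\<Union>w \<in> hyperplanes x0. extensions {0} x w - {x0})"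
    then show "y \<in> hyperplanes x - {x0}" using x0 by (auto simp: hyperplanes_def extensions_def)
  qed
  \<comment> \<open>A hyperplane \<open>y\<close> other than \<open>x0\<close> determines
    \<open>w\<close> as \<open>y \<inter> x0\<close>.\<close>
  have disj: "(extensions {0} x w - {x0}) \<inter> (extensions {0} x w' - {x0}) = {}"
    if "w \<in> hyperplanes x0" "w' \<in> hyperplanes x0" "w \<noteq> w'" for w w'
  proof -
    have False if y: "y \<in> extensions {0} x w" "y \<in> extensions {0} x w'" "y \<noteq> x0" for y
    proof -
      note h = \<open>w \<in> hyperplanes x0\<close> \<open>w' \<in> hyperplanes x0\<close>
      have "x0 = y" if "x0 \<subseteq> y"
        using that y x0 h by (intro subspace_eqI) (auto simp: extensions_def hyperplanes_def)
      then have "y \<inter> x0 \<subset> x0" using y(3) by blast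
      then have "dim (y \<inter> x0) < dim x0"
        using y x0 by (intro dim_less subspace_inter) (auto simp: extensions_def)
      moreover have "u = y \<inter> x0"
        if "u \<in> hyperplanes x0" "y \<in> extensions {0} x u" "dim (y \<inter> x0) < dim x0" for u
        using that x0
        by (intro subspace_eqI subspace_inter) (auto simp: extensions_def hyperplanes_def)
      ultimately have "w = y \<inter> x0" "w' = y \<inter> x0" using y h by blast+
      then show False using \<open>w \<noteq> w'\<close> by simp
    qed
    then show ?thesis by blast
  qed
  have c: "card (extensions {0} x w - {x0}) = ?q" if "w \<in> hyperplanes x0" for w
  proof -
    have w: "subspace w" "w \<subseteq> x" "w \<inter> {0} = {0}" "dim x - dim w = 2"
      using that x0 by (auto simp: hyperplanes_def subspace_0)
    have "x \<inter> {0} = {0}" using subspace_0[OF Suc.prems] by auto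
    then have "card (extensions {0} x w) * (?q - 1) + 1 = ?q * ?q"
      using card_extensions_nat[OF w(1) Suc.prems _ w(3,2)] w(4) by (simp add: power2_eq_square)
    also have "\<dots> = (?q + 1) * (?q - 1) + 1"
      using card_field_gt_1 by (cases ?q) (auto simp: algebra_simps)
    finally have "card (extensions {0} x w) * (?q - 1) = (?q + 1) * (?q - 1)"
      by (simp only: add_right_cancel)
    then have "card (extensions {0} x w) = ?q + 1"
      unfolding mult_cancel2 using card_field_gt_1 by auto
    moreover have "x0 \<in> extensions {0} x w"
      using that x0 subspace_0[OF x0(1)] by (auto simp: extensions_def hyperplanes_def)
    ultimately show ?thesis by simp
  qed
  have "card (hyperplanes x - {x0}) = (\<Sum>w\<in>hyperplanes x0. card (extensions {0} x w - {x0}))"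
    unfolding eq by (intro card_UN_disjoint) (use disj in auto)
  also have "\<dots> = card (hyperplanes x0) * ?q" by (simp add: c)
  finally have "card (hyperplanes x) = card (hyperplanes x0) * ?q + 1"
    using card_Suc_Diff1[of "hyperplanes x" x0] x0 by (simp add: hyperplanes_def)
  then have "card (hyperplanes x) * (?q - 1) + 1 = (card (hyperplanes x0) * (?q - 1) + 1) * ?q"
    using card_field_gt_1 by (cases ?q) (auto simp: algebra_simps)
  then show ?case unfolding IH using Suc.hyps(2)[symmetric] by simp
qed

end

section \<open>Row vectors acted on by the two matrices\<close>

lemma mat_mult_assoc: "X \<star>\<^bsub>I\<^esub> (Y \<star>\<^bsub>I\<^esub> Z) = X \<star>\<^bsub>I\<^esub> Y \<star>\<^bsub>I\<^esub> Z"
proof (intro ext)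
  fix x y
  have "(X \<star>\<^bsub>I\<^esub> (Y \<star>\<^bsub>I\<^esub> Z)) x y = (\<Sum>w\<in>I. \<Sum>v\<in>I. X x w * Y w v * Z v y)"
    by (simp add: mat_mult_def sum_distrib_left mult.assoc)
  also have "\<dots> = (\<Sum>v\<in>I. \<Sum>w\<in>I. X x w * Y w v * Z v y)" by (rule sum.swap)
  finally show "(X \<star>\<^bsub>I\<^esub> (Y \<star>\<^bsub>I\<^esub> Z)) x y = (X \<star>\<^bsub>I\<^esub> Y \<star>\<^bsub>I\<^esub> Z) x y"
    by (simp add: mat_mult_def sum_distrib_right)
qed

lemma mat_mult_distrib:
  "X \<star>\<^bsub>I\<^esub> (Y + Z) = X \<star>\<^bsub>I\<^esub> Y + X \<star>\<^bsub>I\<^esub> Z" "(X + Y) \<star>\<^bsub>I\<^esub> Z = X \<star>\<^bsub>I\<^esub> Z + Y \<star>\<^bsub>I\<^esub> Z"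
  "X \<star>\<^bsub>I\<^esub> (Y - Z) = X \<star>\<^bsub>I\<^esub> Y - X \<star>\<^bsub>I\<^esub> Z" "(X - Y) \<star>\<^bsub>I\<^esub> Z = X \<star>\<^bsub>I\<^esub> Z - Y \<star>\<^bsub>I\<^esub> Z"
  "X \<star>\<^bsub>I\<^esub> (k *\<^sub>m Y) = k *\<^sub>m (X \<star>\<^bsub>I\<^esub> Y)" "(k *\<^sub>m X) \<star>\<^bsub>I\<^esub> Y = k *\<^sub>m (X \<star>\<^bsub>I\<^esub> Y)"
  by (auto simp: fun_eq_iff mat_mult_def mat_scale_def algebra_simps sum.distrib sum_subtractf
      sum_distrib_left)

lemma mat_mult_zero_right: "X \<star>\<^bsub>I\<^esub> 0 = 0"
  by (simp add: fun_eq_iff mat_mult_def)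

text \<open>Matrices will act on row vectors from the right. In this action the raising matrix sums
  over the elements above a point, so it moves the support one level down.\<close>

definition up_sum :: "'i set \<Rightarrow> ('i \<Rightarrow> 'i \<Rightarrow> bool) \<Rightarrow> ('i \<Rightarrow> complex) \<Rightarrow> 'i \<Rightarrow> complex"
  where "up_sum P E f x = (\<Sum>y\<in>{y\<in>P. E x y}. f y)"

definition down_sum :: "'i set \<Rightarrow> ('i \<Rightarrow> 'i \<Rightarrow> bool) \<Rightarrow> ('i \<Rightarrow> complex) \<Rightarrow> 'i \<Rightarrow> complex"
  where "down_sum P E f x = (\<Sum>y\<in>{y\<in>P. E y x}. f y)"

lemma up_sum_mult: "up_sum P E (\<lambda>x. c * f x) = (\<lambda>x. c * up_sum P E f x)"
  and down_sum_mult: "down_sum P E (\<lambda>x. c * f x) = (\<lambda>x. c * down_sum P E f x)"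
  by (simp_all add: fun_eq_iff up_sum_def down_sum_def sum_distrib_left)

text \<open>The relation and its integer level stay abstract because the locale is used twice: with
  dimension, and with the reversed relation and negated dimension. The second use exchanges
  \<open>A\<close> and \<open>As\<close>.\<close>

locale weighted_ranked_relation =
  fixes P :: "'i set" and E :: "'i \<Rightarrow> 'i \<Rightarrow> bool" and lev :: "'i \<Rightarrow> int"
    and \<alpha> \<alpha>s \<theta> \<theta>s :: "int \<Rightarrow> complex" and A As :: "'i cmat"
  assumes finite_P: "finite P"
    and lev_E: "E x y \<Longrightarrow> lev y = lev x + 1"
    and A_eq: "x \<in> P \<Longrightarrow> y \<in> P \<Longrightarrow>
      A y x = (if E x y then \<alpha> (lev x) else 0) + (if x = y then \<theta> (lev x) else 0)"
    and As_eq: "x \<in> P \<Longrightarrow> y \<in> P \<Longrightarrow>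
      As y x = (if E y x then \<alpha>s (lev x) else 0) + (if x = y then \<theta>s (lev x) else 0)"
    and A_out: "x \<notin> P \<Longrightarrow> A y x = 0"
    and As_out: "x \<notin> P \<Longrightarrow> As y x = 0"
begin

abbreviation "up \<equiv> up_sum P E"

abbreviation "down \<equiv> down_sum P E"

definition wt :: "(int \<Rightarrow> complex) \<Rightarrow> ('i \<Rightarrow> complex) \<Rightarrow> 'i \<Rightarrow> complex"
  where "wt c f = (\<lambda>x. if x \<in> P then c (lev x) * f x else 0)"

definition act :: "('i \<Rightarrow> complex) \<Rightarrow> 'i \<Rightarrow> complex"
  where "act f = wt \<theta> f + wt \<alpha> (up f)"

definition acts :: "('i \<Rightarrow> complex) \<Rightarrow> 'i \<Rightarrow> complex"
  where "acts f = wt \<theta>s f + wt \<alpha>s (down f)"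

lemma mult_A: "X \<star>\<^bsub>P\<^esub> A = (\<lambda>z. act (X z))"
proof (intro ext)
  fix z x
  show "(X \<star>\<^bsub>P\<^esub> A) z x = act (X z) x"
  proof (cases "x \<in> P")
    case True
    have "(X \<star>\<^bsub>P\<^esub> A) z x = (\<Sum>y\<in>P. (if E x y then \<alpha> (lev x) * X z y else 0)
        + (if x = y then \<theta> (lev x) * X z y else 0))"
      unfolding mat_mult_def using True by (intro sum.cong refl) (auto simp: A_eq algebra_simps)
    also have "\<dots> = \<alpha> (lev x) * up (X z) x + \<theta> (lev x) * X z x"
      using True finite_P
      by (simp add: sum.distrib up_sum_def sum_distrib_left sum.inter_filter[symmetric])
    finally show ?thesis using True by (simp add: act_def wt_def)
  next
    case False
    then show ?thesis by (simp add: mat_mult_def A_out act_def wt_def)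
  qed
qed

lemma mult_As: "X \<star>\<^bsub>P\<^esub> As = (\<lambda>z. acts (X z))"
proof (intro ext)
  fix z x
  show "(X \<star>\<^bsub>P\<^esub> As) z x = acts (X z) x"
  proof (cases "x \<in> P")
    case True
    have "(X \<star>\<^bsub>P\<^esub> As) z x = (\<Sum>y\<in>P. (if E y x then \<alpha>s (lev x) * X z y else 0)
        + (if x = y then \<theta>s (lev x) * X z y else 0))"
      unfolding mat_mult_def using True by (intro sum.cong refl) (auto simp: As_eq algebra_simps)
    also have "\<dots> = \<alpha>s (lev x) * down (X z) x + \<theta>s (lev x) * X z x"
      using True finite_P
      by (simp add: sum.distrib down_sum_def sum_distrib_left sum.inter_filter[symmetric])
    finally show ?thesis using True by (simp add: acts_def wt_def)
  next
    case False
    then show ?thesis by (simp add: mat_mult_def As_out acts_def wt_def)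
  qed
qed

text \<open>The expanded commutator applied to a row \<open>e\<close>, with the leftmost factor
  innermost. Each of the two middle words arises twice, which produces the coefficient
  \<open>\<beta> + 1\<close>.\<close>

definition word_comb :: "complex \<Rightarrow> complex \<Rightarrow> complex \<Rightarrow> ('i \<Rightarrow> complex) \<Rightarrow> 'i \<Rightarrow> complex"
  where "word_comb \<beta> \<gamma> \<rho> e x = acts (act (act (act e))) x - act (acts (act (act e))) x * (\<beta> + 1)
    + act (act (acts (act e))) x * (\<beta> + 1) - act (act (act (acts e))) x
    - \<gamma> * (acts (act (act e)) x - act (act (acts e)) x)
    - \<rho> * (acts (act e) x - act (acts e) x)"

lemma tridiag_row:
  assumes "tridiag_comm P \<beta> \<gamma> \<rho> A As = 0"
  shows "word_comb \<beta> \<gamma> \<rho> e x = 0"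
proof -
  \<comment> \<open>A matrix with all rows equal to \<open>e\<close> turns the claim into one about
    matrix products.\<close>
  let ?e = "(\<lambda>_. e) :: 'i cmat"
  have "(?e \<star>\<^bsub>P\<^esub> tridiag_comm P \<beta> \<gamma> \<rho> A As) x x = 0"
    unfolding assms by (simp add: mat_mult_zero_right)
  then show ?thesis
    unfolding tridiag_comm_def mat_comm_def mat_mult_distrib mat_mult_assoc
    unfolding mult_A mult_As
    by (simp add: word_comb_def mat_scale_def algebra_simps)
qed

text \<open>Weights pulled out of \<open>up\<close> or \<open>down\<close> need no cut-off outside
  \<open>P\<close>, because the summation over \<open>P\<close> absorbs the one in
  \<open>wt\<close>.\<close>

definition sc :: "(int \<Rightarrow> complex) \<Rightarrow> ('i \<Rightarrow> complex) \<Rightarrow> 'i \<Rightarrow> complex"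
  where "sc c f = (\<lambda>x. c (lev x) * f x)"

lemma wt_apply: "x \<in> P \<Longrightarrow> wt c f x = c (lev x) * f x" and sc_apply: "sc c f x = c (lev x) * f x"
  by (simp_all add: wt_def sc_def)

lemma lev_E': "E x y \<Longrightarrow> lev x = lev y - 1"
  using lev_E by fastforce

lemma up_sc: "up (sc c f) = sc (\<lambda>i. c (i + 1)) (up f)"
  by (auto simp: fun_eq_iff up_sum_def sc_def sum_distrib_left intro!: sum.cong dest!: lev_E)

lemma down_sc: "down (sc c f) = sc (\<lambda>i. c (i - 1)) (down f)"
  by (auto simp: fun_eq_iff down_sum_def sc_def sum_distrib_left intro!: sum.cong dest!: lev_E')

text \<open>These rules bring every word to a level-dependent scalar times an unweighted word in
  \<open>up\<close> and \<open>down\<close>.\<close>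

lemma word_simps:
  "up (f + g) = up f + up g" "down (f + g) = down f + down g"
  "wt c (f + g) = wt c f + wt c g" "sc c (f + g) = sc c f + sc c g"
  "wt c (wt d f) = wt (\<lambda>i. c i * d i) f" "wt c (sc d f) = wt (\<lambda>i. c i * d i) f"
  "sc c (sc d f) = sc (\<lambda>i. c i * d i) f"
  "up (wt c f) = sc (\<lambda>i. c (i + 1)) (up f)" "down (wt c f) = sc (\<lambda>i. c (i - 1)) (down f)"
proof -
  have "up (wt c f) = up (sc c f)" "down (wt c f) = down (sc c f)"
    by (auto simp: fun_eq_iff up_sum_def down_sum_def wt_def sc_def intro!: sum.cong)
  then show "up (wt c f) = sc (\<lambda>i. c (i + 1)) (up f)"
    "down (wt c f) = sc (\<lambda>i. c (i - 1)) (down f)" by (simp_all only: up_sc down_sc)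
qed (simp_all add: fun_eq_iff up_sum_def down_sum_def wt_def sc_def sum.distrib distrib_left)

text \<open>Homogeneity in the grading; it discards by level alone the words that cannot reach a
  given entry.\<close>

definition supported :: "int \<Rightarrow> ('i \<Rightarrow> complex) \<Rightarrow> bool"
  where "supported j f \<longleftrightarrow> (\<forall>x\<in>P. f x \<noteq> 0 \<longrightarrow> lev x = j)"

lemma supported_up:
  assumes "supported (j + 1) f"
  shows "supported j (up f)"
  unfolding supported_def
proof (intro ballI impI)
  fix x assume "up f x \<noteq> 0"
  then obtain y where "y \<in> P" "E x y" "f y \<noteq> 0"
    unfolding up_sum_def by (auto elim: sum.not_neutral_contains_not_neutral)
  then show "lev x = j" using assms lev_E[of x y] by (simp add: supported_def)
qed

lemma supported_down:
  assumes "supported (j - 1) f"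
  shows "supported j (down f)"
  unfolding supported_def
proof (intro ballI impI)
  fix x assume "down f x \<noteq> 0"
  then obtain y where "y \<in> P" "E y x" "f y \<noteq> 0"
    unfolding down_sum_def by (auto elim: sum.not_neutral_contains_not_neutral)
  then show "lev x = j" using assms lev_E[of y x] by (simp add: supported_def)
qed

lemma supportedD: "supported j f \<Longrightarrow> x \<in> P \<Longrightarrow> lev x \<noteq> j \<Longrightarrow> f x = 0"
  unfolding supported_def by blast

text \<open>Only the off-diagonal part of the single factor \<open>As\<close> can lead from
  \<open>z\<close> to \<open>x\<close>, so every \<open>A\<close> contributes its diagonal. The
  entry is \<open>\<alpha>s i\<close> times a polynomial in the two values of
  \<open>\<theta>\<close> that is divisible by their difference.\<close>

lemma lowering_entry:
  assumes tri: "tridiag_comm P \<beta> \<gamma> \<rho> A As = 0"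
    and E: "E z x" and P: "z \<in> P" "x \<in> P" and i: "lev x = i"
    and nz: "\<alpha>s i \<noteq> 0" "\<theta> (i - 1) \<noteq> \<theta> i"
  shows "(\<theta> (i - 1))\<^sup>2 - \<beta> * \<theta> (i - 1) * \<theta> i + (\<theta> i)\<^sup>2 - \<gamma> * (\<theta> (i - 1) + \<theta> i) - \<rho> = 0"
proof -
  define e where "e = (\<lambda>y. if y = z then 1 else 0 :: complex)"
  have s0: "supported (i - 1) e" using E i by (auto simp: supported_def e_def lev_E)
  have s1: "supported (i - 2) (up e)" by (rule supported_up) (use s0 in simp)
  have s2: "supported (i - 3) (up (up e))" by (rule supported_up) (use s1 in simp)
  have s3: "supported (i - 4) (up (up (up e)))" by (rule supported_up) (use s2 in simp)
  have t0: "supported i (down e)" by (rule supported_down) (use s0 in simp)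
  have t1: "supported (i - 1) (down (up e))" "supported (i - 1) (up (down e))"
    by (rule supported_down, use s1 in \<open>simp add: algebra_simps\<close>,
        rule supported_up, use t0 in \<open>simp add: algebra_simps\<close>)
  have t2: "supported (i - 2) (down (up (up e)))" "supported (i - 2) (up (down (up e)))"
      "supported (i - 2) (up (up (down e)))"
    by (rule supported_down, use s2 in simp) (rule supported_up, use t1 in simp)+
  have t3: "supported (i - 3) (down (up (up (up e))))" "supported (i - 3) (up (down (up (up e))))"
      "supported (i - 3) (up (up (down (up e))))" "supported (i - 3) (up (up (up (down e))))"
    by (rule supported_down, use s3 in simp) (rule supported_up, use t2 in simp)+
  note z = s0[THEN supportedD, of x] s1[THEN supportedD, of x] s2[THEN supportedD, of x]
    s3[THEN supportedD, of x] t1[THEN supportedD, of x] t2[THEN supportedD, of x]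
    t3[THEN supportedD, of x]
  have d: "down e x = 1"
    using P E finite_P by (simp add: down_sum_def e_def)
  have "\<alpha>s i * (\<theta> (i - 1) - \<theta> i) *
    ((\<theta> (i - 1))\<^sup>2 - \<beta> * \<theta> (i - 1) * \<theta> i + (\<theta> i)\<^sup>2 - \<gamma> * (\<theta> (i - 1) + \<theta> i) - \<rho>)
    = word_comb \<beta> \<gamma> \<rho> e x"
    using P i
    by (simp add: word_comb_def act_def acts_def word_simps up_sc down_sc wt_apply sc_apply
        z d power2_eq_square) (simp add: algebra_simps)
  then show ?thesis using nz tridiag_row[OF tri, of e x] by simp
qed

text \<open>
  The coefficient of \<open>up (up e)\<close> takes this form only after eliminating \<open>\<gamma>\<close> with the
  three-term recurrence.
\<close>

lemma raising_entry:
  assumes tri: "tridiag_comm P \<beta> \<gamma> \<rho> A As = 0"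
    and x: "x \<in> P" "lev x = i" and e: "supported (i + 2) e"
    and nz: "\<alpha> i \<noteq> 0" "\<alpha> (i + 1) \<noteq> 0"
    and rec: "\<theta> i - \<beta> * \<theta> (i + 1) + \<theta> (i + 2) = \<gamma>"
  shows "\<alpha> (i - 1) * \<alpha>s i * down (up (up (up e))) x
    - (\<beta> + 1) * (\<alpha> i * \<alpha>s (i + 1)) * up (down (up (up e))) x
    + (\<beta> + 1) * (\<alpha> (i + 1) * \<alpha>s (i + 2)) * up (up (down (up e))) x
    - \<alpha> (i + 2) * \<alpha>s (i + 3) * up (up (up (down e))) x
    + (\<beta> + 1) * ((\<theta>s (i + 1) - \<theta>s (i + 2)) * (\<theta> (i + 1) - \<theta> (i + 2))
        - (\<theta>s i - \<theta>s (i + 1)) * (\<theta> i - \<theta> (i + 1))) * up (up e) x = 0"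
    (is "?Z = 0")
proof -
  have s0: "supported (i + 2) e" by (fact e)
  have s1: "supported (i + 1) (up e)" by (rule supported_up) (use s0 in \<open>simp add: algebra_simps\<close>)
  have s2: "supported i (up (up e))" by (rule supported_up) (use s1 in simp)
  have s3: "supported (i - 1) (up (up (up e)))" by (rule supported_up) (use s2 in simp)
  have t0: "supported (i + 3) (down e)" by (rule supported_down) (use s0 in \<open>simp add: algebra_simps\<close>)
  have t1: "supported (i + 2) (down (up e))" "supported (i + 2) (up (down e))"
    by (rule supported_down, use s1 in \<open>simp add: algebra_simps\<close>,
        rule supported_up, use t0 in \<open>simp add: algebra_simps\<close>)
  have t2: "supported (i + 1) (down (up (up e)))" "supported (i + 1) (up (down (up e)))"
      "supported (i + 1) (up (up (down e)))"
    by (rule supported_down, use s2 in simp)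
      (rule supported_up, use t1 in \<open>simp add: algebra_simps\<close>)+
  note z = s0[THEN supportedD, of x] s1[THEN supportedD, of x]
    s3[THEN supportedD, of x] t0[THEN supportedD, of x] t1[THEN supportedD, of x]
    t2[THEN supportedD, of x]
  have n: "1 + i = i + 1" "2 + i = i + 2" "3 + i = i + 3" by simp_all
  have g: "\<gamma> = \<theta> i - \<beta> * \<theta> (i + 1) + \<theta> (i + 2)" using rec by simp
  \<comment> \<open>A surviving word has three ups and one down, or two ups and otherwise diagonal
    factors. All of them carry \<open>\<alpha> i * \<alpha> (i + 1)\<close>; in the former the
    remaining weights pair up to a value of \<xi>.\<close>
  have "\<alpha> i * \<alpha> (i + 1) * ?Z = word_comb \<beta> \<gamma> \<rho> e x"
    using x unfolding g word_comb_def act_def acts_def word_simps up_sc down_sc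
    by (simp add: wt_apply sc_apply z add.assoc, simp only: n) (simp add: algebra_simps)
  then have "\<alpha> i * \<alpha> (i + 1) * ?Z = 0" by (simp only: tridiag_row[OF tri])
  then have "\<alpha> i * \<alpha> (i + 1) = 0 \<or> ?Z = 0" by (rule mult_eq_0_iff[THEN iffD1])
  moreover have "\<alpha> i * \<alpha> (i + 1) \<noteq> 0" using nz by simp
  ultimately show ?thesis by blast
qed

end

section \<open>Solving the recurrences\<close>

text \<open>\<open>m0\<close> and \<open>m1\<close> come from entries whose span meets
  \<open>h\<close> in dimension 0 and 1. After cancelling nonzero factors, eliminate first
  \<open>x0\<close>, then \<open>x1\<close>.\<close>

lemma weights_recurrences:
  fixes q s x0 x1 x2 x3 :: complex
  assumes q: "q \<noteq> 0" "q + 1 \<noteq> 0" "q \<noteq> 1"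
    and m0: "x0 * (q\<^sup>2 + q + 1) * (q + 1) - s * x1 * (q + 1) * (q\<^sup>2 + q + 1)
      + s * x2 * (q\<^sup>2 + q + 1) * (q + 1) - x3 * (q\<^sup>2 + q + 1) * (q + 1) = 0"
    and m1: "x0 * (q\<^sup>2 + q + 1) * (q + 1) - s * x1 * (q + 1) * (q\<^sup>2 + q)
      + s * x2 * (q\<^sup>2 + q) * q = 0"
    and p: "q\<^sup>2 + q + 1 \<noteq> 0"
  shows "x0 - q * s * x2 + q * (q + 1) * x3 = 0"
    and "s * x1 - s * (q + 1) * x2 + (q\<^sup>2 + q + 1) * x3 = 0"
proof -
  have "(q\<^sup>2 + q + 1) * (q + 1) * (x0 - s * x1 + s * x2 - x3) = 0"
    using m0 by (simp add: algebra_simps)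
  then have e0: "x0 - s * x1 + s * x2 - x3 = 0" using q p by simp
  have "(q + 1) * (x0 * (q\<^sup>2 + q + 1) - s * x1 * (q\<^sup>2 + q) + s * x2 * q\<^sup>2) = 0"
    using m1 by (simp add: algebra_simps power2_eq_square)
  then have e1: "x0 * (q\<^sup>2 + q + 1) - s * x1 * (q\<^sup>2 + q) + s * x2 * q\<^sup>2 = 0" using q by simp
  show b: "s * x1 - s * (q + 1) * x2 + (q\<^sup>2 + q + 1) * x3 = 0"
    using e0 e1 by algebra
  show "x0 - q * s * x2 + q * (q + 1) * x3 = 0"
    using e0 b by algebra
qed

text \<open>By \<open>a\<close> and \<open>b\<close> the coefficients of \<open>Q * W\<close>,
  \<open>Q * Z\<close> and \<open>Z\<close> in \<open>S\<close> vanish. Only the multiple of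
  \<open>W\<close> alone survives, and it contains the factor
  \<open>(q - 1)\<^sup>2\<close>.\<close>

lemma weights_difference:
  fixes q s x0 x1 x2 x3 Q W Z d :: complex
  assumes q: "q \<noteq> 0" "q \<noteq> 1"
    and a: "x0 - q * s * x2 + q * (q + 1) * x3 = 0"
    and b: "s * x1 - s * (q + 1) * x2 + (q\<^sup>2 + q + 1) * x3 = 0"
    and S: "x0 * (Q - 1) * (q * q * W - Z) - s * x1 * (q * Q - 1) * (q * W - Z)
      + s * x2 * (q * q * Q - 1) * (W - Z) - x3 * (q * q * q * Q - 1) * (W / q - Z)
      + s * d * (q - 1)\<^sup>2 = 0"
  shows "s * d = s * (q + 1) * W * x2 - (q + 1) * (q\<^sup>2 + q + 1) * (W / q) * x3"
proof -
  define Y where "Y = W / q"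
  have W: "W = q * Y" using q by (simp add: Y_def)
  have Wq: "W / q = Y" by (simp add: Y_def)
  have "(q - 1)\<^sup>2 * (s * d - (s * (q + 1) * W * x2 - (q + 1) * (q\<^sup>2 + q + 1) * Y * x3)) = 0"
    using a b S unfolding Wq unfolding W by algebra
  then show ?thesis using q by (simp add: Wq)
qed

lemma three_term_solution:
  fixes r \<gamma> :: complex and \<theta> :: "nat \<Rightarrow> complex"
  assumes r: "r \<noteq> 0" "r \<noteq> 1" "r \<noteq> -1"
    and rec: "\<And>i. i + 2 \<le> N \<Longrightarrow> \<theta> i - (r + 1 / r) * \<theta> (i + 1) + \<theta> (i + 2) = \<gamma>"
  obtains a b c where "\<And>i. i \<le> N \<Longrightarrow> \<theta> i = a + b * r ^ i + c / r ^ i"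
proof -
  \<comment> \<open>\<open>a\<close> is the constant solution of the recurrence; \<open>b\<close>
    and \<open>c\<close> then fit the values at 0 and 1, which is possible as
    \<open>r\<^sup>2 \<noteq> 1\<close>.\<close>
  define a where "a = - \<gamma> * r / (r - 1)\<^sup>2"
  define b where "b = (r * (\<theta> 1 - a) - (\<theta> 0 - a)) / (r\<^sup>2 - 1)"
  define c where "c = (\<theta> 0 - a) - b"
  have r2: "r\<^sup>2 - 1 \<noteq> 0" using r by (simp add: power2_eq_1_iff)
  have ga: "\<gamma> = (2 - (r + 1 / r)) * a"
  proof -
    have "2 - (r + 1 / r) = - ((r - 1)\<^sup>2 / r)"
      using r(1) by (simp add: field_simps power2_eq_square)
    then show ?thesis using r by (simp add: a_def)
  qed
  have "b * (r\<^sup>2 - 1) = r * (\<theta> 1 - a) - (\<theta> 0 - a)" using r2 by (simp add: b_def)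
  then have "r * (a + b * r + c / r) = r * \<theta> 1"
    using r(1) unfolding c_def by (simp add: field_simps power2_eq_square)
  then have t1: "\<theta> 1 = a + b * r + c / r" using r(1) by simp
  have "i \<le> N \<Longrightarrow> \<theta> i = a + b * r ^ i + c / r ^ i" for i
  proof (induction i rule: less_induct)
    case (less i)
    consider "i = 0" | "i = 1" | j where "i = j + 2"
      by (metis One_nat_def Suc_1 add.commute add_2_eq_Suc' nat.exhaust)
    then show ?case
    proof cases
      case 1
      then show ?thesis by (simp add: c_def)
    next
      case 2
      then show ?thesis using t1 by simp
    next
      case 3
      have "\<theta> (j + 2) = \<gamma> + (r + 1 / r) * \<theta> (j + 1) - \<theta> j"
        using rec[of j] less.prems 3 by (simp add: algebra_simps)
      also have "\<dots> = (2 - (r + 1 / r)) * a + (r + 1 / r) * (a + b * r ^ (j + 1) + c / r ^ (j + 1))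
          - (a + b * r ^ j + c / r ^ j)"
        using less.IH[of j] less.IH[of "j + 1"] less.prems 3 unfolding ga by simp
      also have "\<dots> = a + b * r ^ (j + 2) + c / r ^ (j + 2)"
        using r(1) by (simp add: field_simps power2_eq_square)
      finally show ?thesis using 3 by simp
    qed
  qed
  then show ?thesis using that by blast
qed

text \<open>A difference of consecutive \<open>\<theta>\<close> is
  \<open>(1 - r) * (b * r ^ i - c / r ^ (i + 1))\<close>. In the product of two such differences the
  mixed terms do not depend on \<open>i\<close>, so they cancel here.\<close>

lemma difference_product:
  fixes r :: complex
  assumes "r \<noteq> 0"
    and "\<And>i. i \<le> N \<Longrightarrow> \<theta> i = a + b * r ^ i + c / r ^ i"
    and "\<And>i. i \<le> N \<Longrightarrow> \<theta>s i = as + bs * r ^ i + cs / r ^ i"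
    and "i + 2 \<le> N"
  shows "(\<theta>s (i + 1) - \<theta>s (i + 2)) * (\<theta> (i + 1) - \<theta> (i + 2))
      - (\<theta>s i - \<theta>s (i + 1)) * (\<theta> i - \<theta> (i + 1))
    = (r - 1)\<^sup>2 * (r\<^sup>2 - 1) * (b * bs * (r\<^sup>2) ^ i - c * cs / (r\<^sup>2) ^ (i + 2))"
proof -
  define R where "R = r ^ i"
  have R: "R \<noteq> 0" using assms(1) by (simp add: R_def)
  have e: "r ^ (i + 1) = R * r" "r ^ (i + 2) = R * r * r" "r ^ i = R"
    "(r\<^sup>2) ^ i = R * R" "(r\<^sup>2) ^ (i + 2) = R * R * r * r * r * r"
    by (simp_all add: R_def power_add power2_eq_square power_mult_distrib)
  have t: "\<theta> i = a + b * R + c / R" "\<theta> (i + 1) = a + b * (R * r) + c / (R * r)"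
    "\<theta> (i + 2) = a + b * (R * r * r) + c / (R * r * r)"
    "\<theta>s i = as + bs * R + cs / R" "\<theta>s (i + 1) = as + bs * (R * r) + cs / (R * r)"
    "\<theta>s (i + 2) = as + bs * (R * r * r) + cs / (R * r * r)"
    using assms by (simp_all only: e[symmetric]) (simp_all)
  show ?thesis unfolding t e
    using assms(1) R by (simp add: field_simps power2_eq_square)
qed

text \<open>Unless \<open>q * s = q\<^sup>2 + q + 1\<close>, elimination forces constant ratios
  \<open>x2 / x3 = x3 / x4 = r\<close>. Substituting these back into \<open>b2\<close> determines
  both \<open>q\<close> and \<open>s\<close> in terms of \<open>r\<close>.\<close>

lemma base_dichotomy:
  fixes q s x1 x2 x3 x4 x5 :: complex
  assumes q: "q \<noteq> 0" "q + 1 \<noteq> 0" "q\<^sup>2 + q + 1 \<noteq> 0"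
    and x: "x2 \<noteq> 0" "x3 \<noteq> 0"
    and a1: "x1 - q * s * x3 + q * (q + 1) * x4 = 0"
    and a2: "x2 - q * s * x4 + q * (q + 1) * x5 = 0"
    and b1: "s * x1 - s * (q + 1) * x2 + (q\<^sup>2 + q + 1) * x3 = 0"
    and b2: "s * x2 - s * (q + 1) * x3 + (q\<^sup>2 + q + 1) * x4 = 0"
    and b3: "s * x3 - s * (q + 1) * x4 + (q\<^sup>2 + q + 1) * x5 = 0"
    and s: "q * s \<noteq> q\<^sup>2 + q + 1"
  obtains r where "r\<^sup>2 = q" "s * r = r\<^sup>2 + r + 1" "x3 * r = x2" "x4 * r = x3" "x5 * r = x4"
proof -
  define p where "p = q\<^sup>2 + q + 1"
  have s0: "s \<noteq> 0" using b1 q x by auto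
  \<comment> \<open>Eliminates \<open>x1\<close> and \<open>x4\<close>; the analogous step below
    eliminates \<open>x2\<close> and \<open>x5\<close>.\<close>
  have "(q * s - p) * ((q + 1) * s * x2 - (q * s + p) * x3) = 0"
    using a1 b1 b2 unfolding p_def by algebra
  then have c1: "(q + 1) * s * x2 = (q * s + p) * x3" using s by (simp add: p_def)
  have "(q * s - p) * ((q + 1) * s * x3 - (q * s + p) * x4) = 0"
    using a2 b2 b3 unfolding p_def by algebra
  then have c2: "(q + 1) * s * x3 = (q * s + p) * x4" using s by (simp add: p_def)
  have k: "q * s + p \<noteq> 0" using c1 q s0 x by auto
  define r where "r = (q * s + p) / ((q + 1) * s)"
  have rk: "r * ((q + 1) * s) = q * s + p" using q s0 by (simp add: r_def)
  have r0: "r \<noteq> 0" using k q s0 by (simp add: r_def)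
  have ks: "(q + 1) * s \<noteq> 0" using q s0 by simp
  have "((q + 1) * s) * (x3 * r) = ((q + 1) * s) * x2" using c1 rk by algebra
  then have x3: "x3 * r = x2" using ks by (metis mult_left_cancel)
  have "((q + 1) * s) * (x4 * r) = ((q + 1) * s) * x3" using c2 rk by algebra
  then have x4: "x4 * r = x3" using ks by (metis mult_left_cancel)
  have x4n: "x4 \<noteq> 0" using x4 x by auto
  have "x4 * (s * r\<^sup>2 - s * (q + 1) * r + p) = 0"
    using b2 unfolding x3[symmetric] x4[symmetric] p_def by algebra
  then have e: "s * r\<^sup>2 - s * (q + 1) * r + p = 0" using x4n by simp
  \<comment> \<open>Replacing \<open>r * ((q + 1) * s)\<close> by \<open>q * s + p\<close> cancels
    \<open>p\<close>.\<close>
  have "s * (r\<^sup>2 - q) = 0" using e rk by algebra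
  then have r2: "r\<^sup>2 = q" using s0 by simp
  \<comment> \<open>With \<open>q = r\<^sup>2\<close>, \<open>p\<close> becomes
    \<open>(r\<^sup>2 + r + 1) * (r\<^sup>2 - r + 1)\<close>, and the terms with \<open>s\<close>
    share the second factor.\<close>
  have "(r\<^sup>2 - r + 1) * (s * r - (r\<^sup>2 + r + 1)) = 0"
    using e unfolding p_def r2[symmetric] by algebra
  moreover have "r\<^sup>2 - r + 1 \<noteq> 0"
  proof
    assume z: "r\<^sup>2 - r + 1 = 0"
    have "p = (r\<^sup>2 + r + 1) * (r\<^sup>2 - r + 1)" unfolding p_def r2[symmetric] by algebra
    then show False using z q(3) by (simp add: p_def)
  qed
  ultimately have sr: "s * r = r\<^sup>2 + r + 1" by simp
  have "p * (x5 * r - x4) = 0"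
    using b3 e x4 unfolding p_def by algebra
  then have "x5 * r = x4" using q(3) by (simp add: p_def)
  then show ?thesis using that r2 sr x3 x4 by blast
qed

text \<open>The left sides obey the recurrence with characteristic roots \<open>d\<close> and
  \<open>1 / d\<close>. Applied to the right sides it gives
  \<open>K * (w - d) * (w * d - 1) = 0\<close>.\<close>

lemma geometric_extrapolation:
  fixes u v w d :: complex
  assumes "X * u + Y * v = K" "X * u * d + Y * v / d = K * w" "X * u * d\<^sup>2 + Y * v / d\<^sup>2 = K * w\<^sup>2"
    and d: "d \<noteq> 0" and w: "w \<noteq> d" "w * d \<noteq> 1"
  shows "K = 0"
proof -
  define y where "y = Y * v / d\<^sup>2"
  have "Y * v = y * d\<^sup>2" "Y * v / d = y * d" "Y * v / d\<^sup>2 = y"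
    using d by (simp_all add: y_def power2_eq_square)
  then have f: "X * u + y * d\<^sup>2 = K" "X * u * d + y * d = K * w" "X * u * d\<^sup>2 + y = K * w\<^sup>2"
    using assms(1-3) by simp_all
  have "K * (w - d) * (w * d - 1) = d * K - (d\<^sup>2 + 1) * (K * w) + d * (K * w\<^sup>2)"
    by algebra
  also have "\<dots> = d * (X * u + y * d\<^sup>2) - (d\<^sup>2 + 1) * (X * u * d + y * d) + d * (X * u * d\<^sup>2 + y)"
    by (simp only: f)
  also have "\<dots> = 0" by algebra
  finally have "K * (w - d) * (w * d - 1) = 0" .
  then show ?thesis using w by simp
qed

text \<open>The \<open>x2\<close>, ..., \<open>x5\<close> have ratio \<open>1 / r\<close>, so the
  right sides form a progression of ratio \<open>1 / r ^ 3\<close>. The left sides combine powers of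
  \<open>r\<^sup>2\<close> and its inverse, and neither base equals
  \<open>1 / r ^ 3\<close>.\<close>

lemma square_root_base_impossible:
  fixes r G s x2 x3 x4 x5 :: complex
  assumes r: "r \<noteq> 0" "r \<noteq> 1" "r ^ 3 \<noteq> 1" "r ^ 5 \<noteq> 1" "r\<^sup>2 + 1 \<noteq> 0" "G \<noteq> 0" "x2 \<noteq> 0"
    and s: "s * r = r\<^sup>2 + r + 1" and x: "x3 * r = x2" "x4 * r = x3" "x5 * r = x4"
    and c1: "s * (u * (r\<^sup>2) - v / (r\<^sup>2)) =
      s * (r\<^sup>2 + 1) * (G / (r\<^sup>2) ^ 2) * x2 - (r\<^sup>2 + 1) * ((r\<^sup>2)\<^sup>2 + r\<^sup>2 + 1) * (G / (r\<^sup>2) ^ 3) * x3"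
    and c2: "s * (u * (r\<^sup>2) ^ 2 - v / (r\<^sup>2) ^ 2) =
      s * (r\<^sup>2 + 1) * (G / (r\<^sup>2) ^ 3) * x3 - (r\<^sup>2 + 1) * ((r\<^sup>2)\<^sup>2 + r\<^sup>2 + 1) * (G / (r\<^sup>2) ^ 4) * x4"
    and c3: "s * (u * (r\<^sup>2) ^ 3 - v / (r\<^sup>2) ^ 3) =
      s * (r\<^sup>2 + 1) * (G / (r\<^sup>2) ^ 4) * x4 - (r\<^sup>2 + 1) * ((r\<^sup>2)\<^sup>2 + r\<^sup>2 + 1) * (G / (r\<^sup>2) ^ 5) * x5"
  shows False
proof -
  \<comment> \<open>The right sides are \<open>s\<close> times \<open>K\<close>,
    \<open>K / r ^ 3\<close> and \<open>K / r ^ 6\<close>.\<close>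
  define K where "K = (r\<^sup>2 + 1) * (G / (r\<^sup>2) ^ 2) * (r - 1) / r\<^sup>2 * x2"
  have "(r - 1) * (r\<^sup>2 + r + 1) = r ^ 3 - 1" by algebra
  then have p: "r\<^sup>2 + r + 1 \<noteq> 0" using r by auto
  then have s0: "s \<noteq> 0" using s by auto
  have K0: "K \<noteq> 0" using r by (simp add: K_def)
  have X: "x2 = x5 * r ^ 3" "x3 = x5 * r\<^sup>2" "x4 = x5 * r"
    using x by (auto simp: power2_eq_square power3_eq_cube)
  have S: "s = (r\<^sup>2 + r + 1) / r" using s r by (simp add: field_simps)
  have "s * (u * r\<^sup>2 - v / r\<^sup>2) = s * K"
    unfolding c1 unfolding K_def X S using r(1) by (simp add: field_simps) algebra
  then have k1: "u * r\<^sup>2 + (- v) * (1 / r\<^sup>2) = K" using s0 by simp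
  have "s * (u * (r\<^sup>2) ^ 2 - v / (r\<^sup>2) ^ 2) = s * (K * (1 / r ^ 3))"
    unfolding c2 unfolding K_def X S using r(1) by (simp add: field_simps) algebra
  then have "u * (r\<^sup>2) ^ 2 - v / (r\<^sup>2) ^ 2 = K * (1 / r ^ 3)"
    using mult_left_cancel[OF s0] by blast
  then have k2: "u * r\<^sup>2 * r\<^sup>2 + (- v) * (1 / r\<^sup>2) / r\<^sup>2 = K * (1 / r ^ 3)"
    by (simp add: power2_eq_square mult.assoc)
  have "s * (u * (r\<^sup>2) ^ 3 - v / (r\<^sup>2) ^ 3) = s * (K * (1 / r ^ 3)\<^sup>2)"
    unfolding c3 unfolding K_def X S using r(1) by (simp add: field_simps) algebra
  then have "u * (r\<^sup>2) ^ 3 - v / (r\<^sup>2) ^ 3 = K * (1 / r ^ 3)\<^sup>2"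
    using mult_left_cancel[OF s0] by blast
  then have k3: "u * r\<^sup>2 * (r\<^sup>2)\<^sup>2 + (- v) * (1 / r\<^sup>2) / (r\<^sup>2)\<^sup>2 = K * (1 / r ^ 3)\<^sup>2"
    by (simp add: power2_eq_square power3_eq_cube mult.assoc)
  have "1 / r ^ 3 \<noteq> r\<^sup>2"
  proof
    assume "1 / r ^ 3 = r\<^sup>2"
    then have "1 = r\<^sup>2 * r ^ 3" using r(1) by (simp add: field_simps)
    then show False using r(4) by (simp add: power_add[symmetric])
  qed
  moreover have "1 / r ^ 3 * r\<^sup>2 \<noteq> 1"
    using r by (simp add: power2_eq_square power3_eq_cube)
  ultimately have "K = 0"
    using geometric_extrapolation[OF k1 k2 k3] r(1) by simp
  then show False using K0 by simp
qed

text \<open>The numerical content of the two commutator relations, free of geometry;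
  \<open>s\<close> stands for \<beta> + 1 and \<open>k\<close> for the order of the field.\<close>

locale parameter_system =
  fixes k N M :: nat and q s \<gamma> \<gamma>s :: complex and \<theta> \<theta>s \<xi> :: "nat \<Rightarrow> complex"
  assumes N: "6 \<le> N" and k: "2 \<le> k" and q: "q = of_nat k"
    and \<xi>_nz: "\<And>i. i < N \<Longrightarrow> \<xi> i \<noteq> 0"
    and \<theta>_distinct: "\<And>i j. i \<le> N \<Longrightarrow> j \<le> N \<Longrightarrow> i \<noteq> j \<Longrightarrow> \<theta> i \<noteq> \<theta> j"
    and \<theta>s_distinct: "\<And>i j. i \<le> N \<Longrightarrow> j \<le> N \<Longrightarrow> i \<noteq> j \<Longrightarrow> \<theta>s i \<noteq> \<theta>s j"
    and \<theta>_rec: "\<And>i. i + 2 \<le> N \<Longrightarrow> \<theta> i - (s - 1) * \<theta> (i + 1) + \<theta> (i + 2) = \<gamma>"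
    and \<theta>s_rec: "\<And>i. i + 2 \<le> N \<Longrightarrow> \<theta>s i - (s - 1) * \<theta>s (i + 1) + \<theta>s (i + 2) = \<gamma>s"
    and \<xi>_rec1: "\<And>i. i + 4 \<le> N \<Longrightarrow>
      \<xi> i - q * s * \<xi> (i + 2) + q * (q + 1) * \<xi> (i + 3) = 0"
    and \<xi>_rec2: "\<And>i. i + 4 \<le> N \<Longrightarrow>
      s * \<xi> (i + 1) - s * (q + 1) * \<xi> (i + 2) + (q\<^sup>2 + q + 1) * \<xi> (i + 3) = 0"
    and diff_rec: "\<And>i. i + 4 \<le> N \<Longrightarrow>
      s * ((\<theta>s (i + 2) - \<theta>s (i + 3)) * (\<theta> (i + 2) - \<theta> (i + 3))
        - (\<theta>s (i + 1) - \<theta>s (i + 2)) * (\<theta> (i + 1) - \<theta> (i + 2)))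
      = s * (q + 1) * (q ^ (N + M) / q ^ (i + 2)) * \<xi> (i + 2)
        - (q + 1) * (q\<^sup>2 + q + 1) * (q ^ (N + M) / q ^ (i + 3)) * \<xi> (i + 3)"
begin

lemma q_power_neq_1: "n > 0 \<Longrightarrow> q ^ n \<noteq> 1"
  using k unfolding q of_nat_power[symmetric] of_nat_eq_1_iff by simp

lemma q_nz: "q \<noteq> 0" "q \<noteq> 1" "q + 1 \<noteq> 0" "q\<^sup>2 + q + 1 \<noteq> 0" "q \<noteq> -1"
proof -
  show "q \<noteq> 0" "q \<noteq> 1" using k by (simp_all add: q)
  have "of_nat (k + 1) \<noteq> (0 :: complex)" "of_nat (k\<^sup>2 + k + 1) \<noteq> (0 :: complex)"
    unfolding of_nat_eq_0_iff by simp_all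
  then show "q + 1 \<noteq> 0" "q\<^sup>2 + q + 1 \<noteq> 0" by (simp_all add: q add.commute add.left_commute)
  then show "q \<noteq> -1" by auto
qed

text \<open>Equivalent to \<beta> = q + 1/q. Otherwise \<open>base_dichotomy\<close> supplies a
  square root \<open>r\<close> of \<open>q\<close> with \<beta> = r + 1/r, and three instances of
  \<open>diff_rec\<close> contradict each other.\<close>

lemma s_eq: "q * s = q\<^sup>2 + q + 1"
proof (rule ccontr)
  assume neq: "q * s \<noteq> q\<^sup>2 + q + 1"
  obtain r where r: "r\<^sup>2 = q" "s * r = r\<^sup>2 + r + 1" "\<xi> 3 * r = \<xi> 2" "\<xi> 4 * r = \<xi> 3" "\<xi> 5 * r = \<xi> 4"
    using base_dichotomy[OF q_nz(1,3,4), of "\<xi> 2" "\<xi> 3" "\<xi> 1" s "\<xi> 4" "\<xi> 5"] neq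
      \<xi>_nz[of 2] \<xi>_nz[of 3] \<xi>_rec1[of 1] \<xi>_rec1[of 2] \<xi>_rec2[of 0] \<xi>_rec2[of 1] \<xi>_rec2[of 2] N
    by (auto simp: numeral_eq_Suc)
  have rn: "r ^ n \<noteq> 1" if "n > 0" for n
    using q_power_neq_1[OF that] r(1)
    by (metis mult.commute one_power2 power_mult)
  have r0: "r \<noteq> 0" "r \<noteq> 1" "r \<noteq> -1"
    using r(1) q_nz rn[of 1] by auto
  have s1: "s - 1 = r + 1 / r" using r(2) r0 by (simp add: field_simps power2_eq_square)
  obtain a b c where t: "\<And>i. i \<le> N \<Longrightarrow> \<theta> i = a + b * r ^ i + c / r ^ i"
    using three_term_solution[OF r0, of N \<theta> \<gamma>] \<theta>_rec unfolding s1 by blast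
  obtain as bs cs where ts: "\<And>i. i \<le> N \<Longrightarrow> \<theta>s i = as + bs * r ^ i + cs / r ^ i"
    using three_term_solution[OF r0, of N \<theta>s \<gamma>s] \<theta>s_rec unfolding s1 by blast
  let ?f = "(r - 1)\<^sup>2 * (r\<^sup>2 - 1)"
  \<comment> \<open>The instances 1, 2, 3 are used below; the last one fits because
    \<open>6 \<le> N\<close>.\<close>
  have D: "s * (?f * (b * bs) * (r\<^sup>2) ^ i - ?f * (c * cs) / (r\<^sup>2)\<^sup>2 / (r\<^sup>2) ^ i)
      = s * (r\<^sup>2 + 1) * (q ^ (N + M) / (r\<^sup>2) ^ (i + 1)) * \<xi> (i + 1)
        - (r\<^sup>2 + 1) * ((r\<^sup>2)\<^sup>2 + r\<^sup>2 + 1) * (q ^ (N + M) / (r\<^sup>2) ^ (i + 2)) * \<xi> (i + 2)"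
    if i: "1 \<le> i" "i + 3 \<le> N" for i
  proof -
    obtain j where j: "i = j + 1" using i by (metis add.commute le_Suc_ex)
    have "?f * (b * bs) * (r\<^sup>2) ^ i - ?f * (c * cs) / (r\<^sup>2)\<^sup>2 / (r\<^sup>2) ^ i
        = ?f * (b * bs * (r\<^sup>2) ^ i - c * cs / (r\<^sup>2) ^ (i + 2))"
      using r0 by (simp add: power_add field_simps)
    also have "\<dots> = (\<theta>s (j + 2) - \<theta>s (j + 3)) * (\<theta> (j + 2) - \<theta> (j + 3))
        - (\<theta>s (j + 1) - \<theta>s (j + 2)) * (\<theta> (j + 1) - \<theta> (j + 2))"
      using difference_product[OF r0(1) t ts, where i = "j + 1"] i j by (simp add: numeral_eq_Suc)
    finally show ?thesis
      using diff_rec[of j] i unfolding r(1) j by (simp add: numeral_eq_Suc)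
  qed
  have n: "1 + 1 = (2 :: nat)" "1 + 2 = (3 :: nat)" "2 + 1 = (3 :: nat)" "2 + 2 = (4 :: nat)"
    "3 + 1 = (4 :: nat)" "3 + 2 = (5 :: nat)" by simp_all
  have "\<xi> 2 \<noteq> 0" "q ^ (N + M) \<noteq> 0" "r\<^sup>2 + 1 \<noteq> 0" using \<xi>_nz N q_nz r(1) by simp_all
  note nz = this
  show False
    by (rule square_root_base_impossible[OF r0(1,2) rn[of 3] rn[of 5] nz(3,2,1) r(2-5)
          D[of 1, unfolded n power_one_right] D[of 2, unfolded n] D[of 3, unfolded n]])
       (use N in simp_all)
qed

text \<open>Once \<open>s\<close> is known, \<open>\<xi>_rec2\<close> becomes a recurrence with
  characteristic roots 1 and 1/q.\<close>

lemma \<xi>_form: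
  obtains x y where "\<And>i. i < N \<Longrightarrow> \<xi> i = x + y / q ^ i"
proof -
  have rec0: "\<xi> (i + 1) - (q + 1) * \<xi> (i + 2) + q * \<xi> (i + 3) = 0" if "i + 4 \<le> N" for i
  proof -
    have "(q\<^sup>2 + q + 1) * (\<xi> (i + 1) - (q + 1) * \<xi> (i + 2) + q * \<xi> (i + 3)) = 0"
      using \<xi>_rec2[OF that] s_eq by algebra
    then show ?thesis using q_nz by simp
  qed
  have rec: "\<xi> i - (q + 1) * \<xi> (i + 1) + q * \<xi> (i + 2) = 0" if i: "i + 3 \<le> N" for i
  proof (cases i)
    \<comment> \<open>\<open>rec0\<close> starts only at \<open>\<xi> 1\<close>; the instance
      containing \<open>\<xi> 0\<close> comes from \<open>\<xi>_rec1\<close>.\<close>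
    case 0
    have "\<xi> 1 = (q + 1) * \<xi> 2 - q * \<xi> 3" "\<xi> 0 = q * s * \<xi> 2 - q * (q + 1) * \<xi> 3"
      using rec0[of 0] \<xi>_rec1[of 0] N by (simp_all add: algebra_simps numeral_eq_Suc)
    then have "\<xi> 0 - (q + 1) * \<xi> 1 + q * \<xi> 2 = 0" unfolding s_eq by algebra
    then show ?thesis by (simp add: 0 numeral_eq_Suc)
  next
    case (Suc j)
    then show ?thesis using rec0[of j] i by (simp add: numeral_eq_Suc)
  qed
  \<comment> \<open>Chosen to fit \<open>\<xi> 0\<close> and \<open>\<xi> 1\<close>.\<close>
  define y where "y = (\<xi> 0 - \<xi> 1) * q / (q - 1)"
  define x where "x = \<xi> 0 - y"
  have "i < N \<Longrightarrow> \<xi> i = x + y / q ^ i" for i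
  proof (induction i rule: less_induct)
    case (less i)
    consider "i = 0" | "i = 1" | j where "i = j + 2"
      by (metis One_nat_def Suc_1 add.commute add_2_eq_Suc' nat.exhaust)
    then show ?case
    proof cases
      case 1
      then show ?thesis by (simp add: x_def)
    next
      case 2
      have "y * (q - 1) = (\<xi> 0 - \<xi> 1) * q" using q_nz by (simp add: y_def)
      then show ?thesis using 2 q_nz by (simp add: x_def field_simps)
    next
      case 3
      have "q * \<xi> (j + 2) = (q + 1) * \<xi> (j + 1) - \<xi> j"
        using rec[of j] less.prems 3 by (simp add: algebra_simps)
      also have "\<dots> = (q + 1) * (x + y / q ^ (j + 1)) - (x + y / q ^ j)"
        using less.IH[of j] less.IH[of "j + 1"] less.prems 3 by simp
      also have "\<dots> = q * (x + y / q ^ (j + 2))"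
        using q_nz by (simp add: field_simps)
      finally show ?thesis using 3 q_nz by simp
    qed
  qed
  then show ?thesis using that by blast
qed

text \<open>Inserting the closed forms into \<open>diff_rec\<close> and clearing powers of
  \<open>q\<close> leaves \<open>b * bs\<close> as the coefficient of the only term depending on
  \<open>i\<close>. Two levels therefore force \<open>b * bs = 0\<close>, and any one level then
  gives \<open>y\<close>.\<close>

lemma parameter_forms:
  obtains a b c as bs cs x where
    "\<And>i. i < N \<Longrightarrow> \<xi> i = x - q powi (- 1 - int N - int M - int i) * (q - 1)\<^sup>2 * c * cs"
    "\<And>i. i \<le> N \<Longrightarrow> \<theta> i = a + b * q ^ i + c * q powi (- int i)"
    "\<And>i. i \<le> N \<Longrightarrow> \<theta>s i = as + bs * q ^ i + cs * q powi (- int i)"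
    "b * bs = 0" "b \<noteq> 0 \<or> c \<noteq> 0" "bs \<noteq> 0 \<or> cs \<noteq> 0" "c * cs = 0 \<longrightarrow> x \<noteq> 0"
proof -
  obtain x y where xy: "\<And>i. i < N \<Longrightarrow> \<xi> i = x + y / q ^ i" using \<xi>_form by blast
  have s1: "s - 1 = q + 1 / q" using s_eq q_nz by (simp add: field_simps power2_eq_square)
  obtain a b c where t: "\<And>i. i \<le> N \<Longrightarrow> \<theta> i = a + b * q ^ i + c / q ^ i"
    using three_term_solution[OF q_nz(1,2,5), of N \<theta> \<gamma>] \<theta>_rec unfolding s1 by blast
  obtain as bs cs where ts: "\<And>i. i \<le> N \<Longrightarrow> \<theta>s i = as + bs * q ^ i + cs / q ^ i"
    using three_term_solution[OF q_nz(1,2,5), of N \<theta>s \<gamma>s] \<theta>s_rec unfolding s1 by blast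
  define G where "G = q ^ (N + M)"
  have G: "G \<noteq> 0" using q_nz by (simp add: G_def)
  have s0: "s \<noteq> 0" using s_eq q_nz by auto
  have ps: "q\<^sup>2 + q + 1 = q * s" by (simp add: s_eq)
  have key: "(q - 1)\<^sup>2 * (q * (b * bs) * (q ^ (2 * i + 4)) ^ 2 - c * cs * q) = G * y * q\<^sup>2"
    if i: "i + 4 \<le> N" for i
  proof -
    define R where "R = q ^ i"
    have R: "R \<noteq> 0" using q_nz by (simp add: R_def)
    have e: "q ^ (i + 2) = R * q * q" "q ^ (i + 3) = R * q * q * q" "(q\<^sup>2) ^ (i + 1) = R * R * q * q"
      "(q\<^sup>2) ^ (i + 3) = R * R * q * q * q * q * q * q"
      by (simp_all add: R_def power_add power2_eq_square power3_eq_cube power_mult_distrib)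
    have e4: "q ^ (2 * i + 4) = R\<^sup>2 * q ^ 4"
      by (simp add: R_def power_add power_even_eq)
    have "s * ((q - 1)\<^sup>2 * (q\<^sup>2 - 1) * (b * bs * (q\<^sup>2) ^ (i + 1) - c * cs / (q\<^sup>2) ^ (i + 3)))
        = s * (q + 1) * (G / q ^ (i + 2)) * \<xi> (i + 2) - (q + 1) * (q * s) * (G / q ^ (i + 3)) * \<xi> (i + 3)"
      using diff_rec[OF i] difference_product[OF q_nz(1) t ts, where i = "i + 1"] i
      unfolding G_def ps by (simp add: numeral_eq_Suc)
    also have "\<dots> = s * ((q + 1) * (G / q ^ (i + 2)) * (\<xi> (i + 2) - \<xi> (i + 3)))"
      using q_nz by (simp add: field_simps numeral_eq_Suc)
    finally have "(q - 1)\<^sup>2 * (q\<^sup>2 - 1) * (b * bs * (q\<^sup>2) ^ (i + 1) - c * cs / (q\<^sup>2) ^ (i + 3))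
        = (q + 1) * (G / q ^ (i + 2)) * (\<xi> (i + 2) - \<xi> (i + 3))"
      using mult_left_cancel[OF s0] by blast
    also have "\<xi> (i + 2) - \<xi> (i + 3) = y / q ^ (i + 2) - y / q ^ (i + 3)"
      using xy[of "i + 2"] xy[of "i + 3"] i by simp
    finally have h: "(q - 1)\<^sup>2 * (q\<^sup>2 - 1) * (b * bs * (q\<^sup>2) ^ (i + 1) - c * cs / (q\<^sup>2) ^ (i + 3))
        = (q + 1) * (G / q ^ (i + 2) * (y / q ^ (i + 2) - y / q ^ (i + 3)))"
      by (simp only: mult.assoc)
    define A where "A = b * bs * (q\<^sup>2) ^ (i + 1) - c * cs / (q\<^sup>2) ^ (i + 3)"
    define B where "B = G / q ^ (i + 2) * (y / q ^ (i + 2) - y / q ^ (i + 3))"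
    \<comment> \<open>This power clears the denominators of both \<open>A\<close> and
      \<open>B\<close>.\<close>
    define T where "T = R\<^sup>2 * q ^ 7"
    have A: "A * T = q * (b * bs) * (q ^ (2 * i + 4)) ^ 2 - c * cs * q"
      unfolding A_def T_def e e4 using q_nz R by (simp add: field_simps eval_nat_numeral)
    have B: "B * T = (q - 1) * (G * y * q\<^sup>2)"
      unfolding B_def T_def e using q_nz R by (simp add: field_simps eval_nat_numeral)
    have "(q + 1) * (q - 1) * ((q - 1)\<^sup>2 * (A * T)) = (q - 1)\<^sup>2 * (q\<^sup>2 - 1) * A * T" by algebra
    also have "\<dots> = (q + 1) * B * T" using h by (simp only: A_def B_def)
    also have "\<dots> = (q + 1) * (q - 1) * (G * y * q\<^sup>2)" by (simp only: B mult.assoc)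
    finally have "(q + 1) * (q - 1) * ((q - 1)\<^sup>2 * (A * T)) = (q + 1) * (q - 1) * (G * y * q\<^sup>2)" .
    then have "(q - 1)\<^sup>2 * (A * T) = G * y * q\<^sup>2" using q_nz by simp
    then show ?thesis by (simp only: A)
  qed
  have "(q - 1)\<^sup>2 * q * (b * bs) * ((q ^ 6)\<^sup>2 - (q ^ 4)\<^sup>2) = 0"
    using key[of 0] key[of 1] N by (simp add: algebra_simps)
  moreover have "(q ^ 6)\<^sup>2 - (q ^ 4)\<^sup>2 = q ^ 8 * (q ^ 4 - 1)" by algebra
  ultimately have "(q - 1)\<^sup>2 * q * (b * bs) * (q ^ 8 * (q ^ 4 - 1)) = 0" by (simp only:)
  then have bb: "b * bs = 0"
    using q_nz q_power_neq_1[of 4] by simp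
  have "q * ((q - 1)\<^sup>2 * c * cs + G * y * q) = 0"
    using key[of 0] N bb by (simp add: algebra_simps power2_eq_square)
  then have "(q - 1)\<^sup>2 * c * cs + G * y * q = 0"
    using q_nz(1) by (simp only: mult_eq_0_iff simp_thms)
  then have "y * (G * q) = - ((q - 1)\<^sup>2 * c * cs)" by algebra
  then have y: "y = - ((q - 1)\<^sup>2 * c * cs) / (G * q)" using G q_nz by (simp add: field_simps)
  have pw: "q powi (- int i) = 1 / q ^ i" for i
    by (simp add: power_int_minus field_simps)
  have pw': "q powi (- 1 - int N - int M - int i) = 1 / (G * q * q ^ i)" for i
  proof -
    have eq: "- 1 - int N - int M - int i = - int (N + M + 1 + i)" by simp
    show ?thesis unfolding eq pw G_def by (simp add: power_add)
  qed
  show ?thesis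
  proof (rule that[of x c cs a b as bs])
    show "\<xi> i = x - q powi (- 1 - int N - int M - int i) * (q - 1)\<^sup>2 * c * cs" if "i < N" for i
      using xy[OF that] by (simp add: pw' y)
    \<comment> \<open>Here \<open>y\<close> vanishes, so \<open>x\<close> is the nonzero value
      \<open>\<xi> 0\<close>.\<close>
    show "c * cs = 0 \<longrightarrow> x \<noteq> 0"
      using xy[of 0] \<xi>_nz[of 0] N by (auto simp: y)
    show "b \<noteq> 0 \<or> c \<noteq> 0" using t[of 0] t[of 1] \<theta>_distinct[of 0 1] N by auto
    show "bs \<noteq> 0 \<or> cs \<noteq> 0" using ts[of 0] ts[of 1] \<theta>s_distinct[of 0 1] N by auto
  qed (use t ts bb in \<open>simp_all add: pw\<close>)
qed

end

section \<open>Counting in the attenuated space\<close>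

locale attenuated = finite_field_space scale Basis
  for scale :: "'k::{field,finite} \<Rightarrow> 'v::ab_group_add \<Rightarrow> 'v" and Basis +
  fixes h :: "'v set" and N M :: nat
  assumes dim_space: "dim UNIV = N + M" and subspace_h: "subspace h" and dim_h: "dim h = M"
begin

abbreviation "P \<equiv> attenuated_space scale h"

definition E :: "'v set \<Rightarrow> 'v set \<Rightarrow> bool"
  where "E x y \<longleftrightarrow> x \<in> P \<and> y \<in> P \<and> x \<subseteq> y \<and> dim y = Suc (dim x)"

lemma P_iff: "x \<in> P \<longleftrightarrow> subspace x \<and> x \<inter> h = {0}"
  by (simp add: attenuated_space_def)

lemma P_subset: "y \<in> P \<Longrightarrow> subspace x \<Longrightarrow> x \<subseteq> y \<Longrightarrow> x \<in> P"
  using subspace_0[of x] subspace_0[OF subspace_h] by (auto simp: P_iff)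

text \<open>\<open>P\<close> is closed under passing to subspaces, so adjoining a single vector of
  \<open>y\<close> to \<open>x\<close> stays in \<open>P\<close> and no cover can skip a
  dimension.\<close>

lemma covers_iff: "covers_in P y x \<longleftrightarrow> E x y"
proof
  assume c: "covers_in P y x"
  then have xy: "x \<in> P" "y \<in> P" "x \<subset> y" by (auto simp: covers_in_def)
  then have sub: "subspace x" "subspace y" by (auto simp: P_iff)
  obtain v where v: "v \<in> y" "v \<notin> x" using xy by auto
  let ?z = "span (insert v x)"
  have z: "x \<subset> ?z" "?z \<subseteq> y"
    using v xy sub span_superset[of "insert v x"] span_minimal[of "insert v x" y] by auto
  then have "?z \<in> P" using P_subset[of y ?z] xy by simp
  then have "?z = y" using c z by (auto simp: covers_in_def)
  then have "dim y = Suc (dim x)" using dim_insert_Suc[OF sub(1) v(2)] by (metis dim_span)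
  then show "E x y" using xy by (auto simp: E_def)
next
  assume e: "E x y"
  have False if z: "z \<in> P" "x \<subset> z" "z \<subset> y" for z
    using dim_less[of x z] dim_less[of z y] z e by (auto simp: E_def P_iff)
  moreover have "x \<noteq> y" using e by (auto simp: E_def)
  ultimately show "covers_in P y x" using e unfolding covers_in_def E_def by blast
qed

lemma dim_P_le: "x \<in> P \<Longrightarrow> dim x \<le> N"
  using dim_span_Un_Int[of x h] dim_subset[of "span (x \<union> h)" UNIV] subspace_h dim_h dim_space
  by (simp add: P_iff)

definition q :: complex where "q = of_nat CARD('k)"

text \<open>The q-integer: the number of hyperplanes of an n-dimensional space.\<close>

definition br :: "nat \<Rightarrow> complex" where "br n = (q ^ n - 1) / (q - 1)"

definition ind :: "'v set \<Rightarrow> nat \<Rightarrow> 'v set \<Rightarrow> complex"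
  where "ind X j x = (if x \<in> P \<and> x \<subseteq> X \<and> dim x = j then 1 else 0)"

text \<open>By \<open>card_extensions\<close>, the number of covers inside the subspace
  \<open>X\<close> of a j-dimensional element of \<open>P\<close> contained in
  \<open>X\<close>.\<close>

definition cnt :: "'v set \<Rightarrow> nat \<Rightarrow> complex"
  where "cnt X j = (q ^ (dim X - j) - q ^ dim (X \<inter> h)) / (q - 1)"

lemma q_nz: "q \<noteq> 0" "q \<noteq> 1" "q - 1 \<noteq> 0"
  using card_field_gt_1 by (simp_all add: q_def)

lemma extensions_h: "x \<in> P \<Longrightarrow> extensions h X x = {y. E x y \<and> y \<subseteq> X}"
  by (auto simp: extensions_def E_def P_iff)

lemma up_ind:
  assumes X: "subspace X"
  shows "up_sum P E (ind X (Suc j)) = (\<lambda>x. cnt X j * ind X j x)"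
proof
  fix x
  have "up_sum P E (ind X (Suc j)) x = of_nat (card {y. E x y \<and> y \<subseteq> X \<and> dim y = Suc j})"
    unfolding up_sum_def ind_def
    by (subst sum.inter_filter[symmetric]) (auto intro!: arg_cong[where f = card] simp: E_def)
  also have "\<dots> = cnt X j * ind X j x"
  proof (cases "x \<in> P \<and> x \<subseteq> X \<and> dim x = j")
    case True
    then have "{y. E x y \<and> y \<subseteq> X \<and> dim y = Suc j} = extensions h X x"
      by (auto simp: extensions_h E_def)
    then show ?thesis
      using card_extensions[of x X h] True X subspace_h by (simp add: ind_def cnt_def q_def P_iff)
  next
    case False
    then have "{y. E x y \<and> y \<subseteq> X \<and> dim y = Suc j} = {}" by (auto simp: E_def)
    then show ?thesis using False by (auto simp: ind_def simp del: Collect_empty_eq)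
  qed
  finally show "up_sum P E (ind X (Suc j)) x = cnt X j * ind X j x" .
qed

text \<open>With no restriction to a smaller \<open>X\<close>, all hyperplanes of an element of
  \<open>P\<close> count, so the number depends on its dimension alone.\<close>

lemma down_ind_UNIV: "down_sum P E (ind UNIV j) = (\<lambda>x. br (Suc j) * ind UNIV (Suc j) x)"
proof
  fix x
  have "down_sum P E (ind UNIV j) x = of_nat (card {y. E y x \<and> dim y = j})"
    unfolding down_sum_def ind_def
    by (subst sum.inter_filter[symmetric]) (auto intro!: arg_cong[where f = card] simp: E_def)
  also have "\<dots> = br (Suc j) * ind UNIV (Suc j) x"
  proof (cases "x \<in> P \<and> dim x = Suc j")
    case True
    then have "{y. E y x \<and> dim y = j} = hyperplanes x"
      using P_subset[of x] by (auto simp: E_def hyperplanes_def P_iff)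
    moreover have "of_nat (card (hyperplanes x) * (CARD('k) - 1) + 1) = q ^ Suc j"
      using card_hyperplanes[of x] True by (simp only: P_iff q_def of_nat_power)
    then have "of_nat (card (hyperplanes x)) * (q - 1) + 1 = q ^ Suc j"
      using card_field_gt_1 by (simp add: of_nat_diff q_def add.commute)
    then have "of_nat (card (hyperplanes x)) = br (Suc j)"
      using q_nz unfolding br_def by (simp add: field_simps)
    ultimately show ?thesis using True by (simp add: ind_def)
  next
    case False
    then have "{y. E y x \<and> dim y = j} = {}" by (auto simp: E_def)
    then show ?thesis using False by (auto simp: ind_def simp del: Collect_empty_eq)
  qed
  finally show "down_sum P E (ind UNIV j) x = br (Suc j) * ind UNIV (Suc j) x" .
qed

section \<open>Existence of elements and covers on prescribed levels\<close>

lemma exists_cover: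
  assumes "x \<in> P" "dim x < N"
  obtains y where "E x y"
proof -
  have "card (extensions h UNIV x) * (CARD('k) - 1) + CARD('k) ^ M = CARD('k) ^ (N + M - dim x)"
    using card_extensions_nat[of x UNIV h] assms subspace_h
    by (simp add: P_iff dim_h dim_space del: dim_UNIV)
  moreover have "CARD('k) ^ M \<noteq> CARD('k) ^ (N + M - dim x)"
    using assms card_field_gt_1 by simp
  ultimately have "extensions h UNIV x \<noteq> {}" by auto
  then show ?thesis using that extensions_h[OF assms(1)] by auto
qed

lemma exists_level:
  assumes "i \<le> N" "x \<in> P" "dim x \<le> i"
  obtains y where "y \<in> P" "x \<subseteq> y" "dim y = i"
  using assms
proof (induction "i - dim x" arbitrary: x thesis)
  case 0
  then show ?case by auto
next
  case (Suc n)
  then have "dim x < N" by simp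
  with Suc.prems obtain y where y: "E x y" using exists_cover[of x] by metis
  show ?case
  proof (rule Suc.hyps(1)[of y])
    show "n = i - dim y" "y \<in> P" "dim y \<le> i" "i \<le> N"
      using y Suc.hyps(2) Suc.prems by (auto simp: E_def)
  qed (use y Suc.prems(1) in \<open>auto simp: E_def\<close>)
qed

lemma zero_in_P: "{0} \<in> P" and dim_zero: "dim {0} = 0"
  using subspace_0[OF subspace_h] by (auto simp: P_iff)

lemma exists_covering_pair:
  assumes "i < N"
  obtains x y where "E x y" "dim x = i"
proof -
  obtain x where "x \<in> P" "dim x = i" using exists_level[of i "{0}"] zero_in_P dim_zero assms by auto
  then show ?thesis using exists_cover[of x] assms that by auto
qed

text \<open>The positions of the entries to be evaluated, on level i = j + 1. Since \<open>x\<close>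
  is not inside \<open>z\<close>, the word with two raisings contributes nothing, and
  \<open>x\<close> and \<open>z\<close> span dimension \<open>j + 4\<close>.\<close>

definition skew_pair :: "nat \<Rightarrow> 'v set \<Rightarrow> 'v set \<Rightarrow> bool"
  where "skew_pair j x z \<longleftrightarrow> x \<in> P \<and> z \<in> P \<and> dim x = Suc j \<and> dim z = j + 3 \<and> dim (x \<inter> z) = j"

text \<open>
  Above the first member of a skew pair, lying over a hyperplane of \<open>z\<close> is the same as lying
  in \<open>x + z\<close>.
\<close>

lemma down_ind_skew:
  assumes xz: "skew_pair j x z" and y: "y \<in> P" "x \<subseteq> y"
  shows "down_sum P E (ind z k) y = ind (span (x \<union> z)) (Suc k) y"
proof -
  let ?X = "span (x \<union> z)"
  note xz' = xz[unfolded skew_pair_def]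
  have sub: "subspace x" "subspace y" "subspace z" using xz' y by (auto simp: P_iff)
  have dX: "dim ?X = j + 4"
    using dim_span_Un_Int[OF sub(1,3)] xz' by simp
  have yz: "\<not> y \<subseteq> z"
  proof
    assume "y \<subseteq> z"
    then have "x \<inter> z = x" using y by auto
    then show False using xz' by auto
  qed
  have sum: "down_sum P E (ind z k) y = of_nat (card {w. E w y \<and> w \<subseteq> z \<and> dim w = k})"
    unfolding down_sum_def ind_def
    by (subst sum.inter_filter[symmetric]) (auto intro!: arg_cong[where f = card] simp: E_def)
  have dyz: "dim (span (y \<union> z)) + dim (y \<inter> z) = dim y + (j + 3)"
    using dim_span_Un_Int[OF sub(2,3)] xz' by simp
  have Xyz: "?X \<subseteq> span (y \<union> z)" using y by (intro span_mono) auto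
  have lt: "dim (y \<inter> z) < dim y"
    using yz sub by (intro dim_less subspace_inter) auto
  show ?thesis
  proof (cases "y \<subseteq> ?X \<and> dim y = Suc k")
    case True
    have "span (y \<union> z) \<subseteq> ?X"
      using True span_superset[of "x \<union> z"] by (intro span_minimal) auto
    then have "span (y \<union> z) = ?X" using Xyz by auto
    then have d: "dim (y \<inter> z) = k" using dyz dX True by simp
    \<comment> \<open>\<open>y \<inter> z\<close> is itself a hyperplane of \<open>y\<close>, hence
      the only one contained in \<open>z\<close>.\<close>
    have "{w. E w y \<and> w \<subseteq> z \<and> dim w = k} = {y \<inter> z}"
    proof (intro equalityI subsetI)
      fix w assume "w \<in> {w. E w y \<and> w \<subseteq> z \<and> dim w = k}"
      then have "w = y \<inter> z" using d sub
        by (intro subspace_eqI subspace_inter) (auto simp: E_def P_iff)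
      then show "w \<in> {y \<inter> z}" by simp
    next
      fix w assume "w \<in> {y \<inter> z}"
      then show "w \<in> {w. E w y \<and> w \<subseteq> z \<and> dim w = k}"
        using d True y sub P_subset[of y "y \<inter> z"] subspace_inter by (auto simp: E_def)
    qed
    then show ?thesis using True y sum by (simp add: ind_def)
  next
    case False
    have "{w. E w y \<and> w \<subseteq> z \<and> dim w = k} = {}"
    proof (rule ccontr)
      assume "{w. E w y \<and> w \<subseteq> z \<and> dim w = k} \<noteq> {}"
      then obtain w where w: "w \<in> P" "w \<subseteq> y" "w \<subseteq> z" "dim w = k" "dim y = Suc k"
        by (auto simp: E_def)
      then have "k \<le> dim (y \<inter> z)" using dim_subset[of w "y \<inter> z"] by auto
      then have "dim (y \<inter> z) = k" using lt w by simp
      then have "dim (span (y \<union> z)) = dim ?X" using dyz dX w by simp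
      then have "?X = span (y \<union> z)" using Xyz by (intro subspace_eqI) auto
      then have "y \<subseteq> ?X" using span_superset[of "y \<union> z"] by auto
      then show False using False w by simp
    qed
    then show ?thesis using False sum by (simp only: ind_def) auto
  qed
qed

text \<open>\<open>down_ind_skew\<close> holds only above \<open>x\<close>, but sums over elements
  above \<open>x\<close> see nothing else, so it may be applied inside them.\<close>

lemma up_sum_cong_above:
  assumes "\<And>y. y \<in> P \<Longrightarrow> x \<subseteq> y \<Longrightarrow> f y = g y" and "x \<subseteq> w"
  shows "up_sum P E f w = up_sum P E g w"
  unfolding up_sum_def using assms by (intro sum.cong refl) (auto simp: E_def)

text \<open>\<open>e\<close> is the indicator of \<open>z\<close>. Raisings applied before the
  lowering count inside \<open>z\<close> and give factors \<open>br\<close>; those applied after it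
  count inside the span of \<open>x\<close> and \<open>z\<close> and give factors
  \<open>c\<close>.\<close>

lemma skew_counts:
  assumes xz: "skew_pair j x z"
  defines "e \<equiv> ind z (j + 3)"
    and "c \<equiv> \<lambda>n. (q ^ n - q ^ dim (span (x \<union> z) \<inter> h)) / (q - 1)"
  shows "down_sum P E (up_sum P E (up_sum P E (up_sum P E e))) x = br 1 * br 2 * br 3"
    and "up_sum P E (down_sum P E (up_sum P E (up_sum P E e))) x = br 1 * br 2 * c 3"
    and "up_sum P E (up_sum P E (down_sum P E (up_sum P E e))) x = br 1 * c 2 * c 3"
    and "up_sum P E (up_sum P E (up_sum P E (down_sum P E e))) x = c 1 * c 2 * c 3"
    and "up_sum P E (up_sum P E e) x = 0"
proof -
  let ?X = "span (x \<union> z)" and ?U = "up_sum P E" and ?V = "down_sum P E"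
  note xz' = xz[unfolded skew_pair_def]
  have sub: "subspace x" "subspace z" "subspace ?X" using xz' by (auto simp: P_iff)
  have xX: "x \<subseteq> ?X" using span_superset[of "x \<union> z"] by auto
  have dX: "dim ?X = j + 4"
    using dim_span_Un_Int[OF sub(1,2)] xz' by simp
  have "z \<inter> h = {0}" using xz' by (simp add: P_iff)
  then have cz: "cnt z (j + 2) = br 1" "cnt z (j + 1) = br 2" "cnt z j = br 3"
    using xz' by (simp_all add: cnt_def br_def)
  have cX: "cnt ?X (j + 3) = c 1" "cnt ?X (j + 2) = c 2" "cnt ?X (j + 1) = c 3"
    unfolding cnt_def c_def dX by simp_all
  have U1: "?U e = (\<lambda>y. br 1 * ind z (j + 2) y)"
    unfolding e_def using up_ind[OF sub(2), of "j + 2"] by (simp only: cz) (simp add: numeral_eq_Suc)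
  have U2: "?U (?U e) = (\<lambda>y. br 1 * br 2 * ind z (j + 1) y)"
    unfolding U1 up_sum_mult using up_ind[OF sub(2), of "j + 1"]
    by (simp only: cz) (simp add: numeral_eq_Suc mult.assoc)
  have U3: "?U (?U (?U e)) = (\<lambda>y. br 1 * br 2 * br 3 * ind z j y)"
    unfolding U2 up_sum_mult using up_ind[OF sub(2), of j] by (simp add: cz mult.assoc)
  have W1: "?U (ind ?X (j + 2)) = (\<lambda>y. c 3 * ind ?X (j + 1) y)"
    using up_ind[OF sub(3), of "j + 1"] by (simp only: cX) simp
  have W2: "?U (ind ?X (j + 3)) = (\<lambda>y. c 2 * ind ?X (j + 2) y)"
    using up_ind[OF sub(3), of "j + 2"] by (simp only: cX) (simp add: numeral_eq_Suc)
  have W3: "?U (ind ?X (j + 4)) = (\<lambda>y. c 1 * ind ?X (j + 3) y)"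
    using up_ind[OF sub(3), of "j + 3"] by (simp only: cX) (simp add: numeral_eq_Suc)
  have x1: "ind ?X (j + 1) x = 1" using xz' xX by (simp add: ind_def)
  have V: "?V (ind z k) y = ind ?X (k + 1) y" if "y \<in> P" "x \<subseteq> y" for y k
    using down_ind_skew[OF xz that] by simp
  show "?V (?U (?U (?U e))) x = br 1 * br 2 * br 3"
    unfolding U3 down_sum_mult using V[of x j] xz' x1 by simp
  have f2: "?U (?V (ind z (j + 1))) x = ?U (ind ?X (j + 2)) x"
    by (rule up_sum_cong_above[OF _ order_refl]) (simp add: V)
  show "?U (?V (?U (?U e))) x = br 1 * br 2 * c 3"
    unfolding U2 down_sum_mult up_sum_mult f2 W1 x1 by simp
  have f1: "?U (?U (?V (ind z (j + 2)))) x = ?U (?U (ind ?X (j + 3))) x"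
    by (intro up_sum_cong_above[where x = x]) (simp_all add: V numeral_eq_Suc)
  show "?U (?U (?V (?U e))) x = br 1 * c 2 * c 3"
    unfolding U1 down_sum_mult up_sum_mult f1 W2 W1 x1 by simp
  have f0: "?U (?U (?U (?V e))) x = ?U (?U (?U (ind ?X (j + 4)))) x"
    unfolding e_def by (intro up_sum_cong_above[where x = x]) (simp_all add: V numeral_eq_Suc)
  show "?U (?U (?U (?V e))) x = c 1 * c 2 * c 3"
    unfolding f0 W3 W2 W1 up_sum_mult x1 by simp
  have "\<not> x \<subseteq> z"
  proof
    assume "x \<subseteq> z"
    then have "x \<inter> z = x" by auto
    then show False using xz' by auto
  qed
  then show "?U (?U e) x = 0" unfolding U2 by (simp add: ind_def)
qed

lemma skew_pair_in_hyperplane: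
  assumes X: "subspace X" "dim X = j + 4" and x: "x \<in> P" "x \<subseteq> X" "dim x = Suc j"
    and z: "z \<in> P" "z \<subseteq> X" "dim z = j + 3" and v: "v \<in> x" "v \<notin> z"
  shows "skew_pair j x z" "span (x \<union> z) = X"
proof -
  have sub: "subspace x" "subspace z" using x z by (auto simp: P_iff)
  have le: "span (x \<union> z) \<subseteq> X" using x z X by (intro span_minimal) auto
  have "z \<subset> span (x \<union> z)" using span_superset[of "x \<union> z"] v by auto
  then have "dim z < dim (span (x \<union> z))" using sub by (intro dim_less) auto
  then show eq: "span (x \<union> z) = X" using le X z by (intro subspace_eqI) auto
  show "skew_pair j x z"
    using dim_span_Un_Int[OF sub] x z X unfolding eq by (simp add: skew_pair_def)
qed

text \<open>Choose the ambient \<open>X\<close> inside \<open>P\<close>, so that it meets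
  \<open>h\<close> trivially, and let \<open>z\<close> be a hyperplane of \<open>X\<close> missing a
  vector of \<open>x\<close>.\<close>

lemma exists_skew_pair_0:
  assumes "j + 4 \<le> N"
  obtains x z where "skew_pair j x z" "dim (span (x \<union> z) \<inter> h) = 0"
proof -
  obtain x where x: "x \<in> P" "dim x = Suc j"
    using exists_level[of "Suc j" "{0}"] zero_in_P dim_zero assms by auto
  obtain X where X: "X \<in> P" "x \<subseteq> X" "dim X = j + 4"
    using exists_level[of "j + 4" x] x assms by auto
  have "\<not> x \<subseteq> {0}" using x(2) dim_subset[of x "{0}"] dim_zero by auto
  then obtain v where v: "v \<in> x" "v \<notin> {0}" by auto
  obtain z where z: "subspace z" "z \<subseteq> X" "v \<notin> z" "Suc (dim z) = dim X"
  proof (rule exists_hyperplane[of X "{0}" v])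
    show "subspace X" "{0} \<subseteq> X" using X subspace_0[of X] by (auto simp: P_iff)
  qed (use v X in auto)
  have "z \<in> P" using P_subset X z by blast
  then have "skew_pair j x z" "span (x \<union> z) = X"
    using skew_pair_in_hyperplane[of X j x z v] X x z v by (auto simp: P_iff)
  then show ?thesis using that X dim_zero by (auto simp: P_iff)
qed

text \<open>
  A hyperplane through \<open>v - u\<close> that misses \<open>v \<in> x\<close> also misses \<open>u \<in> h\<close>, so it meets \<open>h\<close>
  trivially inside \<open>Y + \<langle>u\<rangle>\<close>.
\<close>

lemma exists_skew_pair_1:
  assumes "j + 4 \<le> N" "M \<ge> 1"
  obtains x z where "skew_pair j x z" "dim (span (x \<union> z) \<inter> h) = 1"
proof -
  obtain x where x: "x \<in> P" "dim x = Suc j"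
    using exists_level[of "Suc j" "{0}"] zero_in_P dim_zero assms by auto
  obtain Y where Y: "Y \<in> P" "x \<subseteq> Y" "dim Y = j + 3"
    using exists_level[of "j + 3" x] x assms by auto
  have "\<not> x \<subseteq> {0}" using x(2) dim_subset[of x "{0}"] dim_zero by auto
  then obtain v where v: "v \<in> x" "v \<noteq> 0" by auto
  have "\<not> h \<subseteq> {0}" using dim_h assms dim_subset[of h "{0}"] dim_zero by auto
  then obtain u where u: "u \<in> h" "u \<noteq> 0" by auto
  have subY: "subspace Y" using Y by (simp add: P_iff)
  have uY: "u \<notin> Y" using u Y by (auto simp: P_iff)
  define X where "X = span (insert u Y)"
  have X: "subspace X" "dim X = j + 4" "Y \<subseteq> X" "u \<in> X"
    using dim_insert_Suc[of Y u] uY Y span_superset[of "insert u Y"] by (auto simp: X_def P_iff)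
  have Xh: "X \<inter> h = span {u}"
  proof (intro equalityI subsetI)
    fix w assume w: "w \<in> X \<inter> h"
    then obtain k where k: "w - scale k u \<in> Y"
      using span_eq_iff[THEN iffD2, OF subY] by (auto simp: X_def span_breakdown_eq)
    moreover have "w - scale k u \<in> h"
      using w u subspace_h by (auto intro: subspace_diff subspace_scale)
    moreover have "Y \<inter> h = {0}" using Y by (simp add: P_iff)
    ultimately have "w - scale k u = 0" by blast
    then show "w \<in> span {u}" by (auto simp: span_singleton)
  next
    fix w assume "w \<in> span {u}"
    then show "w \<in> X \<inter> h" using X u subspace_h by (auto simp: span_singleton intro: subspace_scale)
  qed
  have vX: "v \<in> X" using v x Y X by auto
  \<comment> \<open>If \<open>v\<close> were a multiple of \<open>v - u\<close>, a relation between
    \<open>u\<close> and \<open>v\<close> would lie in both \<open>h\<close> and \<open>x\<close>,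
    forcing one of the two vectors to vanish.\<close>
  have vK: "v \<notin> span {v - u}"
  proof
    assume "v \<in> span {v - u}"
    then obtain k where k: "v = scale k (v - u)" by (auto simp: span_singleton)
    then have e: "scale k u = scale (k - 1) v" by (simp add: algebra_simps)
    have "scale k u \<in> h" using u subspace_h by (auto intro: subspace_scale)
    moreover have "scale (k - 1) v \<in> x" using v x by (auto simp: P_iff intro: subspace_scale)
    moreover have "x \<inter> h = {0}" using x by (simp add: P_iff)
    ultimately have "scale k u = 0" "scale (k - 1) v = 0" using e by (metis IntI singletonD)+
    then show False using u v by auto
  qed
  obtain z where z: "subspace z" "span {v - u} \<subseteq> z" "z \<subseteq> X" "v \<notin> z" "Suc (dim z) = dim X"
  proof (rule exists_hyperplane[OF X(1) _ _ vX vK])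
    show "span {v - u} \<subseteq> X" using X vX by (intro span_minimal) (auto intro: subspace_diff)
  qed (auto intro: that)
  have "v - u \<in> z" using z(2) span_base[of "v - u" "{v - u}"] by auto
  then have uz: "u \<notin> z" using z subspace_add[of z "v - u" u] by auto
  have "z \<inter> h \<subseteq> {0}"
  proof
    fix w assume w: "w \<in> z \<inter> h"
    then have "w \<in> span {u}" using z(3) Xh by auto
    then obtain k where k: "w = scale k u" by (auto simp: span_singleton)
    have "k = 0"
    proof (rule ccontr)
      assume "k \<noteq> 0"
      then have "u = scale (inverse k) w" by (simp add: k)
      then show False using uz w z(1) by (auto intro: subspace_scale)
    qed
    then show "w \<in> {0}" using k by simp
  qed
  then have "z \<in> P" using z(1) subspace_0[OF z(1)] subspace_0[OF subspace_h] by (auto simp: P_iff)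
  then have "skew_pair j x z" "span (x \<union> z) = X"
    using skew_pair_in_hyperplane[of X j x z v] X x z v Y by auto
  then show ?thesis using that Xh u by auto
qed

end

section \<open>From the matrix relations to the parameter relations\<close>

lemma sum_fun_apply: "(\<Sum>i\<in>I. f i) x = (\<Sum>i\<in>I. f i x)" for f :: "'i \<Rightarrow> 'a \<Rightarrow> 'b::comm_monoid_add"
  by (induction I rule: infinite_finite_induct) simp_all

text \<open>Subtracting the two quadratic relations leaves a product with factor
  \<open>t0 - t2\<close>.\<close>

lemma quadratic_imp_three_term:
  fixes t0 t1 t2 :: complex
  assumes "t0\<^sup>2 - \<beta> * t0 * t1 + t1\<^sup>2 - \<gamma> * (t0 + t1) - \<rho> = 0"
    and "t1\<^sup>2 - \<beta> * t1 * t2 + t2\<^sup>2 - \<gamma> * (t1 + t2) - \<rho> = 0"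
    and "t0 \<noteq> t2"
  shows "t0 - \<beta> * t1 + t2 = \<gamma>"
proof -
  have "(t0 - t2) * (t0 - \<beta> * t1 + t2 - \<gamma>) = 0" using assms(1,2) by algebra
  then show ?thesis using assms(3) by simp
qed

context attenuated
begin

lemma level_sum_entry:
  assumes F: "\<And>i. i \<in> I \<Longrightarrow> F i = diag_ind_mat (attenuated_level scale h i)" and "finite I"
  shows "(\<Sum>i\<in>I. c i *\<^sub>m F i) y x = (if x \<in> P \<and> dim x \<in> I \<and> x = y then c (dim x) else 0)"
    and "(\<Sum>i\<in>I. c i *\<^sub>m (X \<star>\<^bsub>P\<^esub> F i)) y x = (if x \<in> P \<and> dim x \<in> I then c (dim x) * X y x else 0)"
proof -
  have Fe: "F i z x = (if dim x = i then if z = x \<and> x \<in> P then 1 else 0 else 0)" if "i \<in> I" for i z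
    using F[OF that] by (auto simp: diag_ind_mat_def attenuated_level_def)
  have "(\<Sum>i\<in>I. c i *\<^sub>m F i) y x
      = (\<Sum>i\<in>I. if dim x = i then if y = x \<and> x \<in> P then c i else 0 else 0)"
    unfolding sum_fun_apply by (intro sum.cong refl) (auto simp: mat_scale_def Fe)
  also have "\<dots> = (if x \<in> P \<and> dim x \<in> I \<and> x = y then c (dim x) else 0)"
    by (subst sum.delta') (use \<open>finite I\<close> in auto)
  finally show "(\<Sum>i\<in>I. c i *\<^sub>m F i) y x = (if x \<in> P \<and> dim x \<in> I \<and> x = y then c (dim x) else 0)" .
  have XF: "(X \<star>\<^bsub>P\<^esub> F i) y x = (if dim x = i then if x \<in> P then X y x else 0 else 0)" if "i \<in> I" for i
  proof -
    have "(X \<star>\<^bsub>P\<^esub> F i) y x = (\<Sum>z\<in>P. if z = x then if dim x = i then X y x else 0 else 0)"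
      unfolding mat_mult_def by (intro sum.cong refl) (auto simp: Fe[OF that])
    then show ?thesis by simp
  qed
  have "(\<Sum>i\<in>I. c i *\<^sub>m (X \<star>\<^bsub>P\<^esub> F i)) y x
      = (\<Sum>i\<in>I. if dim x = i then if x \<in> P then c i * X y x else 0 else 0)"
    unfolding sum_fun_apply by (intro sum.cong refl) (auto simp: mat_scale_def XF)
  also have "\<dots> = (if x \<in> P \<and> dim x \<in> I then c (dim x) * X y x else 0)"
    by (subst sum.delta') (use \<open>finite I\<close> in auto)
  finally show "(\<Sum>i\<in>I. c i *\<^sub>m (X \<star>\<^bsub>P\<^esub> F i)) y x
    = (if x \<in> P \<and> dim x \<in> I then c (dim x) * X y x else 0)" .
qed

lemma br_simps: "br 1 = 1" "br 2 = q + 1" "br 3 = q\<^sup>2 + q + 1"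
  using q_nz by (simp_all add: br_def field_simps power2_eq_square power3_eq_cube)

lemma cnt_UNIV: "j + i \<le> N \<Longrightarrow> cnt UNIV (j + i) = (q ^ (N + M) / q ^ (j + i) - q ^ M) / (q - 1)"
  using q_nz subspace_h by (simp add: cnt_def dim_space dim_h power_diff del: dim_UNIV)

lemma cnt_UNIV_nz: "i < N \<Longrightarrow> cnt UNIV i \<noteq> 0"
proof -
  assume i: "i < N"
  have "CARD('k) ^ (N + M - i) \<noteq> CARD('k) ^ M" using i card_field_gt_1 by simp
  then have "q ^ (N + M - i) \<noteq> q ^ M"
    unfolding q_def of_nat_power[symmetric] of_nat_eq_iff .
  then show ?thesis using q_nz by (simp add: cnt_def dim_space dim_h del: dim_UNIV)
qed

text \<open>These are the entries summed over all \<open>z\<close> of one level. Indicators of whole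
  levels are mapped to multiples of each other, so each word becomes a product of counts.\<close>

lemma level_counts:
  assumes x: "x \<in> P" "dim x = Suc j"
  defines "e \<equiv> ind UNIV (j + 3)"
  shows "down_sum P E (up_sum P E (up_sum P E (up_sum P E e))) x
      = cnt UNIV (j + 2) * cnt UNIV (j + 1) * (cnt UNIV j * br (j + 1))"
    and "up_sum P E (down_sum P E (up_sum P E (up_sum P E e))) x
      = cnt UNIV (j + 2) * cnt UNIV (j + 1) * (cnt UNIV (j + 1) * br (j + 2))"
    and "up_sum P E (up_sum P E (down_sum P E (up_sum P E e))) x
      = cnt UNIV (j + 2) * cnt UNIV (j + 1) * (cnt UNIV (j + 2) * br (j + 3))"
    and "up_sum P E (up_sum P E (up_sum P E (down_sum P E e))) x
      = cnt UNIV (j + 2) * cnt UNIV (j + 1) * (cnt UNIV (j + 3) * br (j + 4))"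
    and "up_sum P E (up_sum P E e) x = cnt UNIV (j + 2) * cnt UNIV (j + 1)"
proof -
  have x1: "ind UNIV (Suc j) x = 1" using x by (simp add: ind_def)
  have n: "j + 1 = Suc j" "j + 2 = Suc (Suc j)" "j + 3 = Suc (Suc (Suc j))"
    "j + 4 = Suc (Suc (Suc (Suc j)))" by simp_all
  note r = e_def n up_ind[OF subspace_UNIV] down_ind_UNIV up_sum_mult down_sum_mult x1
  show "down_sum P E (up_sum P E (up_sum P E (up_sum P E e))) x
      = cnt UNIV (j + 2) * cnt UNIV (j + 1) * (cnt UNIV j * br (j + 1))"
    "up_sum P E (down_sum P E (up_sum P E (up_sum P E e))) x
      = cnt UNIV (j + 2) * cnt UNIV (j + 1) * (cnt UNIV (j + 1) * br (j + 2))"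
    "up_sum P E (up_sum P E (down_sum P E (up_sum P E e))) x
      = cnt UNIV (j + 2) * cnt UNIV (j + 1) * (cnt UNIV (j + 2) * br (j + 3))"
    "up_sum P E (up_sum P E (up_sum P E (down_sum P E e))) x
      = cnt UNIV (j + 2) * cnt UNIV (j + 1) * (cnt UNIV (j + 3) * br (j + 4))"
    "up_sum P E (up_sum P E e) x = cnt UNIV (j + 2) * cnt UNIV (j + 1)"
    unfolding r by (simp_all add: mult_ac)
qed

text \<open>Three choices of \<open>X\<close> suffice: the \<open>z\<close> of a skew pair with span
  disjoint from \<open>h\<close> up to 0, the \<open>z\<close> of one whose span meets
  \<open>h\<close> in a line, and the whole space.\<close>

lemma weights_of_relation:
  fixes x0 x1 x2 x3 d s :: complex
  assumes j: "j + 4 \<le> N" and M: "1 \<le> M"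
    and rel: "\<And>x X. x \<in> P \<Longrightarrow> dim x = Suc j \<Longrightarrow>
      x0 * down_sum P E (up_sum P E (up_sum P E (up_sum P E (ind X (j + 3))))) x
      - s * x1 * up_sum P E (down_sum P E (up_sum P E (up_sum P E (ind X (j + 3))))) x
      + s * x2 * up_sum P E (up_sum P E (down_sum P E (up_sum P E (ind X (j + 3))))) x
      - x3 * up_sum P E (up_sum P E (up_sum P E (down_sum P E (ind X (j + 3))))) x
      + s * d * up_sum P E (up_sum P E (ind X (j + 3))) x = 0"
  shows "x0 - q * s * x2 + q * (q + 1) * x3 = 0"
    and "s * x1 - s * (q + 1) * x2 + (q\<^sup>2 + q + 1) * x3 = 0"
    and "s * d = s * (q + 1) * (q ^ (N + M) / q ^ (j + 2)) * x2
        - (q + 1) * (q\<^sup>2 + q + 1) * (q ^ (N + M) / q ^ (j + 3)) * x3"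
proof -
  have "of_nat (CARD('k) + 1) \<noteq> (0 :: complex)"
    "of_nat (CARD('k)\<^sup>2 + CARD('k) + 1) \<noteq> (0 :: complex)"
    unfolding of_nat_eq_0_iff by simp_all
  then have p: "q + 1 \<noteq> 0" "q\<^sup>2 + q + 1 \<noteq> 0"
    by (simp_all add: q_def add.commute add.left_commute)
  obtain x z where xz: "skew_pair j x z" "dim (span (x \<union> z) \<inter> h) = 0"
    using exists_skew_pair_0[OF j] by blast
  have "x0 * (q\<^sup>2 + q + 1) * (q + 1) - s * x1 * (q + 1) * (q\<^sup>2 + q + 1)
      + s * x2 * (q\<^sup>2 + q + 1) * (q + 1) - x3 * (q\<^sup>2 + q + 1) * (q + 1) = 0"
    using rel[of x z] xz(1) unfolding skew_counts[OF xz(1)] xz(2) skew_pair_def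
    unfolding power_0 br_def[symmetric] br_simps by (simp add: mult_ac)
  note m0 = this
  obtain x z where xz: "skew_pair j x z" "dim (span (x \<union> z) \<inter> h) = 1"
    using exists_skew_pair_1[OF j M] by blast
  \<comment> \<open>The three factors for a one-dimensional intersection; the zero removes the term
    with \<open>x3\<close>.\<close>
  have c: "(q ^ 1 - q ^ 1) / (q - 1) = 0" "(q ^ 2 - q ^ 1) / (q - 1) = q"
    "(q ^ 3 - q ^ 1) / (q - 1) = q\<^sup>2 + q"
    using q_nz by (simp_all add: field_simps power2_eq_square power3_eq_cube)
  have "x0 * (q\<^sup>2 + q + 1) * (q + 1) - s * x1 * (q + 1) * (q\<^sup>2 + q)
      + s * x2 * (q\<^sup>2 + q) * q = 0"
    using rel[of x z] xz(1) unfolding skew_counts[OF xz(1)] xz(2) skew_pair_def c br_simps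
    by (simp add: mult_ac)
  note m1 = this
  show ab: "x0 - q * s * x2 + q * (q + 1) * x3 = 0"
    "s * x1 - s * (q + 1) * x2 + (q\<^sup>2 + q + 1) * x3 = 0"
    using weights_recurrences[OF q_nz(1) p(1) q_nz(2) m0 m1 p(2)] by blast+
  obtain x where x: "x \<in> P" "dim x = Suc j"
    using exists_level[of "Suc j" "{0}"] zero_in_P dim_zero j by auto
  have "cnt UNIV (j + 2) * cnt UNIV (j + 1) * (x0 * (cnt UNIV j * br (j + 1))
      - s * x1 * (cnt UNIV (j + 1) * br (j + 2)) + s * x2 * (cnt UNIV (j + 2) * br (j + 3))
      - x3 * (cnt UNIV (j + 3) * br (j + 4)) + s * d) = 0"
    using rel[OF x, of UNIV] unfolding level_counts[OF x] by (simp add: algebra_simps)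
  moreover have "cnt UNIV (j + 2) * cnt UNIV (j + 1) \<noteq> 0" using cnt_UNIV_nz j by simp
  ultimately have S: "x0 * (cnt UNIV j * br (j + 1))
      - s * x1 * (cnt UNIV (j + 1) * br (j + 2)) + s * x2 * (cnt UNIV (j + 2) * br (j + 3))
      - x3 * (cnt UNIV (j + 3) * br (j + 4)) + s * d = 0"
    by (metis mult_eq_0_iff)
  define Q where "Q = q ^ (j + 1)"
  define W where "W = q ^ (N + M) / q ^ (j + 2)"
  have u: "cnt UNIV j = (q * q * W - q ^ M) / (q - 1)" "cnt UNIV (j + 1) = (q * W - q ^ M) / (q - 1)"
    "cnt UNIV (j + 2) = (W - q ^ M) / (q - 1)" "cnt UNIV (j + 3) = (W / q - q ^ M) / (q - 1)"
    using cnt_UNIV[of j 0] cnt_UNIV[of j 1] cnt_UNIV[of j 2] cnt_UNIV[of j 3] j q_nz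
    by (simp_all add: W_def numeral_eq_Suc)
  have b: "br (j + 1) = (Q - 1) / (q - 1)" "br (j + 2) = (q * Q - 1) / (q - 1)"
    "br (j + 3) = (q * q * Q - 1) / (q - 1)" "br (j + 4) = (q * q * q * Q - 1) / (q - 1)"
    by (simp_all add: br_def Q_def numeral_eq_Suc)
  have "x0 * (Q - 1) * (q * q * W - q ^ M) - s * x1 * (q * Q - 1) * (q * W - q ^ M)
      + s * x2 * (q * q * Q - 1) * (W - q ^ M) - x3 * (q * q * q * Q - 1) * (W / q - q ^ M)
      + s * d * (q - 1)\<^sup>2
    = (q - 1)\<^sup>2 * (x0 * (cnt UNIV j * br (j + 1))
      - s * x1 * (cnt UNIV (j + 1) * br (j + 2)) + s * x2 * (cnt UNIV (j + 2) * br (j + 3))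
      - x3 * (cnt UNIV (j + 3) * br (j + 4)) + s * d)"
  proof -
    have r: "v * A * C = (q - 1)\<^sup>2 * (v * (C / (q - 1) * (A / (q - 1))))" for v A C
      using q_nz by (simp add: power2_eq_square)
    have "x0 * (Q - 1) * (q * q * W - q ^ M) = (q - 1)\<^sup>2 * (x0 * (cnt UNIV j * br (j + 1)))"
      "s * x1 * (q * Q - 1) * (q * W - q ^ M)
        = (q - 1)\<^sup>2 * (s * x1 * (cnt UNIV (j + 1) * br (j + 2)))"
      "s * x2 * (q * q * Q - 1) * (W - q ^ M)
        = (q - 1)\<^sup>2 * (s * x2 * (cnt UNIV (j + 2) * br (j + 3)))"
      "x3 * (q * q * q * Q - 1) * (W / q - q ^ M)
        = (q - 1)\<^sup>2 * (x3 * (cnt UNIV (j + 3) * br (j + 4)))"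
      "s * d * (q - 1)\<^sup>2 = (q - 1)\<^sup>2 * (s * d)"
      unfolding u b by (rule r)+ (rule mult.commute)
    then show ?thesis by (simp only: distrib_left right_diff_distrib)
  qed
  also have "\<dots> = 0" unfolding S by simp
  finally have "s * d = s * (q + 1) * W * x2 - (q + 1) * (q\<^sup>2 + q + 1) * (W / q) * x3"
    by (rule weights_difference[OF q_nz(1,2) ab])
  moreover have "W / q = q ^ (N + M) / q ^ (j + 3)"
    using q_nz by (simp add: W_def numeral_eq_Suc)
  ultimately show "s * d = s * (q + 1) * (q ^ (N + M) / q ^ (j + 2)) * x2
        - (q + 1) * (q\<^sup>2 + q + 1) * (q ^ (N + M) / q ^ (j + 3)) * x3"
    by (simp only: W_def)
qed

lemma parameter_system_of_relations:
  fixes \<alpha> \<alpha>s \<theta> \<theta>s :: "nat \<Rightarrow> complex" and \<beta> \<gamma> \<gamma>s \<rho> \<rho>s :: complex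
  assumes N: "6 \<le> N" and M: "1 \<le> M"
    and F: "\<And>i. i \<le> N \<Longrightarrow> F i = diag_ind_mat (attenuated_level scale h i)"
    and \<alpha>: "\<And>i. i < N \<Longrightarrow> \<alpha> i \<noteq> 0"
    and \<alpha>s: "\<And>i. 1 \<le> i \<Longrightarrow> i \<le> N \<Longrightarrow> \<alpha>s i \<noteq> 0"
    and \<theta>: "\<And>i j. i \<le> N \<Longrightarrow> j \<le> N \<Longrightarrow> i \<noteq> j \<Longrightarrow> \<theta> i \<noteq> \<theta> j"
    and \<theta>s: "\<And>i j. i \<le> N \<Longrightarrow> j \<le> N \<Longrightarrow> i \<noteq> j \<Longrightarrow> \<theta>s i \<noteq> \<theta>s j"
    and A: "A = (\<Sum>i=0..N-1. \<alpha> i *\<^sub>m (raising_mat P \<star>\<^bsub>P\<^esub> F i)) + (\<Sum>i=0..N. \<theta> i *\<^sub>m F i)"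
    and As: "As = (\<Sum>i=1..N. \<alpha>s i *\<^sub>m (lowering_mat P \<star>\<^bsub>P\<^esub> F i)) + (\<Sum>i=0..N. \<theta>s i *\<^sub>m F i)"
    and B: "tridiag_comm P \<beta> \<gamma> \<rho> A As = 0"
    and Bs: "tridiag_comm P \<beta> \<gamma>s \<rho>s As A = 0"
  shows "parameter_system CARD('k) N M q (\<beta> + 1) \<gamma> \<gamma>s \<theta> \<theta>s (\<lambda>i. \<alpha> i * \<alpha>s (i + 1))"
proof -
  have A_eq: "A y x = (if E x y then \<alpha> (dim x) else 0) + (if x = y then \<theta> (dim x) else 0)"
    if "x \<in> P" "y \<in> P" for x y
  proof -
    \<comment> \<open>An element with a cover has dimension below \<open>N\<close>, so the sum
      ending at \<open>N-1\<close> misses no nonzero entry of the raising matrix.\<close>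
    have "E x y \<Longrightarrow> dim x \<le> N - 1" using dim_P_le[of y] by (auto simp: E_def)
    then show ?thesis
      using that dim_P_le[of x] F unfolding A plus_fun_apply
      by (subst (1 2) level_sum_entry) (auto simp: raising_mat_def covers_iff)
  qed
  have As_eq: "As y x = (if E y x then \<alpha>s (dim x) else 0) + (if x = y then \<theta>s (dim x) else 0)"
    if "x \<in> P" "y \<in> P" for x y
  proof -
    have "E y x \<Longrightarrow> 1 \<le> dim x" by (auto simp: E_def)
    then show ?thesis
      using that dim_P_le[of x] F unfolding As plus_fun_apply
      by (subst (1 2) level_sum_entry) (auto simp: lowering_mat_def covers_iff)
  qed
  have out: "A y x = 0" "As y x = 0" if "x \<notin> P" for x y
    using that F unfolding A As plus_fun_apply by (subst (1 2) level_sum_entry; auto)+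
  interpret W: weighted_ranked_relation P E "\<lambda>x. int (dim x)" "\<lambda>i. \<alpha> (nat i)" "\<lambda>i. \<alpha>s (nat i)"
    "\<lambda>i. \<theta> (nat i)" "\<lambda>i. \<theta>s (nat i)" A As
    by unfold_locales (auto simp: A_eq As_eq out, simp add: E_def)
  \<comment> \<open>The dual reading: with the order reversed, \<open>As\<close> plays the part of
    \<open>A\<close>.\<close>
  interpret W': weighted_ranked_relation P "\<lambda>x y. E y x" "\<lambda>x. - int (dim x)"
    "\<lambda>i. \<alpha>s (nat (- i))" "\<lambda>i. \<alpha> (nat (- i))"
    "\<lambda>i. \<theta>s (nat (- i))" "\<lambda>i. \<theta> (nat (- i))" As A
    by unfold_locales (auto simp: A_eq As_eq out, simp add: E_def)
  have \<theta>2: "(\<theta> i)\<^sup>2 - \<beta> * \<theta> i * \<theta> (i + 1) + (\<theta> (i + 1))\<^sup>2 - \<gamma> * (\<theta> i + \<theta> (i + 1)) - \<rho> = 0"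
    if i: "i < N" for i
  proof -
    obtain z x where zx: "E z x" "dim z = i" using exists_covering_pair[OF i] by blast
    then have "z \<in> P" "x \<in> P" "dim x = i + 1" by (auto simp: E_def)
    then show ?thesis
      using W.lowering_entry[OF B zx(1), of "int (i + 1)"] \<alpha>s[of "i + 1"] \<theta>[of i "i + 1"] i
      by (simp add: nat_add_distrib)
  qed
  have \<theta>s2: "(\<theta>s i)\<^sup>2 - \<beta> * \<theta>s i * \<theta>s (i + 1) + (\<theta>s (i + 1))\<^sup>2 - \<gamma>s * (\<theta>s i + \<theta>s (i + 1)) - \<rho>s = 0"
    if i: "i < N" for i
  proof -
    obtain x z where zx: "E x z" "dim x = i" using exists_covering_pair[OF i] by blast
    then have "z \<in> P" "x \<in> P" "dim z = i + 1" by (auto simp: E_def)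
    then have "(\<theta>s (i + 1))\<^sup>2 - \<beta> * \<theta>s (i + 1) * \<theta>s i + (\<theta>s i)\<^sup>2
        - \<gamma>s * (\<theta>s (i + 1) + \<theta>s i) - \<rho>s = 0"
      using W'.lowering_entry[OF Bs zx(1), of "- int i"] \<alpha>[of i] \<theta>s[of i "i + 1"] i zx(2)
      by (simp add: nat_add_distrib add.commute)
    then show ?thesis by algebra
  qed
  have \<theta>r: "\<theta> i - \<beta> * \<theta> (i + 1) + \<theta> (i + 2) = \<gamma>" if "i + 2 \<le> N" for i
    using quadratic_imp_three_term[OF \<theta>2[of i] \<theta>2[of "i + 1", unfolded add.assoc one_add_one]]
      that \<theta>[of i "i + 2"] by simp
  have \<theta>sr: "\<theta>s i - \<beta> * \<theta>s (i + 1) + \<theta>s (i + 2) = \<gamma>s" if "i + 2 \<le> N" for i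
    using quadratic_imp_three_term[OF \<theta>s2[of i] \<theta>s2[of "i + 1", unfolded add.assoc one_add_one]]
      that \<theta>s[of i "i + 2"] by simp
  let ?\<xi> = "\<lambda>i. \<alpha> i * \<alpha>s (i + 1)"
  let ?D = "\<lambda>j. (\<theta>s (j + 2) - \<theta>s (j + 3)) * (\<theta> (j + 2) - \<theta> (j + 3))
    - (\<theta>s (j + 1) - \<theta>s (j + 2)) * (\<theta> (j + 1) - \<theta> (j + 2))"
  have rel: "?\<xi> j * down_sum P E (up_sum P E (up_sum P E (up_sum P E (ind X (j + 3))))) x
      - (\<beta> + 1) * ?\<xi> (j + 1) * up_sum P E (down_sum P E (up_sum P E (up_sum P E (ind X (j + 3))))) x
      + (\<beta> + 1) * ?\<xi> (j + 2) * up_sum P E (up_sum P E (down_sum P E (up_sum P E (ind X (j + 3))))) x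
      - ?\<xi> (j + 3) * up_sum P E (up_sum P E (up_sum P E (down_sum P E (ind X (j + 3))))) x
      + (\<beta> + 1) * ?D j * up_sum P E (up_sum P E (ind X (j + 3))) x = 0"
    if x: "x \<in> P" "dim x = Suc j" and j: "j + 4 \<le> N" for x X j
  proof -
    \<comment> \<open>At level \<open>Suc j\<close> all shifted indices, including the one below,
      are nonnegative, so \<open>nat\<close> truncates nothing.\<close>
    have n: "nat (int (Suc j) - 1) = j" "nat (int (Suc j)) = j + 1" "nat (int (Suc j) + 1) = j + 2"
      "nat (int (Suc j) + 2) = j + 3" "nat (int (Suc j) + 3) = j + 4"
      by simp_all
    have n': "j + 1 + 1 = j + 2" "j + 2 + 1 = j + 3" "j + 3 + 1 = j + 4" "j + 1 + 2 = j + 3" by simp_all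
    have "W.supported (int (Suc j) + 2) (ind X (j + 3))"
      by (auto simp: W.supported_def ind_def)
    from W.raising_entry[OF B x(1) _ this, unfolded n] x(2) \<alpha>[of "j + 1"] \<alpha>[of "j + 2"] \<theta>r[of "j + 1"] j
    show ?thesis unfolding n' by simp
  qed
  show ?thesis
  proof
    show "2 \<le> CARD('k)" using card_field_gt_1 by simp
    show "q = of_nat CARD('k)" by (simp add: q_def)
    show "\<alpha> i * \<alpha>s (i + 1) \<noteq> 0" if "i < N" for i using \<alpha> \<alpha>s that by simp
    show "\<theta> i - (\<beta> + 1 - 1) * \<theta> (i + 1) + \<theta> (i + 2) = \<gamma>" if "i + 2 \<le> N" for i
      using \<theta>r[OF that] by simp
    show "\<theta>s i - (\<beta> + 1 - 1) * \<theta>s (i + 1) + \<theta>s (i + 2) = \<gamma>s" if "i + 2 \<le> N" for i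
      using \<theta>sr[OF that] by simp
    show "?\<xi> i - q * (\<beta> + 1) * ?\<xi> (i + 2) + q * (q + 1) * ?\<xi> (i + 3) = 0"
      "(\<beta> + 1) * ?\<xi> (i + 1) - (\<beta> + 1) * (q + 1) * ?\<xi> (i + 2) + (q\<^sup>2 + q + 1) * ?\<xi> (i + 3) = 0"
      "(\<beta> + 1) * ?D i = (\<beta> + 1) * (q + 1) * (q ^ (N + M) / q ^ (i + 2)) * ?\<xi> (i + 2)
        - (q + 1) * (q\<^sup>2 + q + 1) * (q ^ (N + M) / q ^ (i + 3)) * ?\<xi> (i + 3)"
      if "i + 4 \<le> N" for i
      using weights_of_relation[OF that M rel[OF _ _ that]] by blast+
  qed (use N \<theta> \<theta>s in auto)
qed

end

theorem theorem11p25: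
  fixes scale :: "'k::{field,finite} \<Rightarrow> 'v::ab_group_add \<Rightarrow> 'v"
    and h :: "'v set" and N M :: nat and q :: complex
    and P :: "'v set set" and L R A As :: "'v set cmat" and F :: "nat \<Rightarrow> 'v set cmat"
    and \<alpha> \<alpha>s \<theta> \<theta>s \<xi> :: "nat \<Rightarrow> complex"
    and \<beta> \<gamma> \<gamma>s \<rho> \<rho>s :: complex
  assumes "N \<ge> 6" and "M \<ge> 1"
    and q: "q = of_nat CARD('k)"
    and "vector_space scale"
    and "vector_space.dim scale (UNIV :: 'v set) = N + M"
    and "module.subspace scale h" and "vector_space.dim scale h = M"
    and P: "P = attenuated_space scale h"
    and L: "L = lowering_mat P"
    and R: "R = raising_mat P"
    and F: "\<And>i. i \<le> N \<Longrightarrow> F i = diag_ind_mat (attenuated_level scale h i)"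
    and "\<And>i. i < N \<Longrightarrow> \<alpha> i \<noteq> 0"
    and "\<And>i. 1 \<le> i \<Longrightarrow> i \<le> N \<Longrightarrow> \<alpha>s i \<noteq> 0"
    and "\<And>i j. i \<le> N \<Longrightarrow> j \<le> N \<Longrightarrow> i \<noteq> j \<Longrightarrow> \<theta> i \<noteq> \<theta> j"
    and "\<And>i j. i \<le> N \<Longrightarrow> j \<le> N \<Longrightarrow> i \<noteq> j \<Longrightarrow> \<theta>s i \<noteq> \<theta>s j"
    and \<xi>: "\<And>i. i < N \<Longrightarrow> \<xi> i = \<alpha> i * \<alpha>s (i + 1)"
    and A: "A = (\<Sum>i=0..N-1. \<alpha> i *\<^sub>m (R \<star>\<^bsub>P\<^esub> F i)) + (\<Sum>i=0..N. \<theta> i *\<^sub>m F i)"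
    and As: "As = (\<Sum>i=1..N. \<alpha>s i *\<^sub>m (L \<star>\<^bsub>P\<^esub> F i)) + (\<Sum>i=0..N. \<theta>s i *\<^sub>m F i)"
    and B: "tridiag_comm P \<beta> \<gamma> \<rho> A As = 0"
    and Bs: "tridiag_comm P \<beta> \<gamma>s \<rho>s As A = 0"
  shows "\<exists>a b c as bs cs x :: complex.
    \<comment> \<open>I+\<close>
    (b \<noteq> 0 \<and> bs = 0 \<and> c \<noteq> 0 \<and> cs \<noteq> 0 \<and>
      (\<forall>i<N. \<xi> i = x - q powi (- 1 - int N - int M - int i) * (q - 1)\<^sup>2 * c * cs) \<and>
      (\<forall>i\<le>N. \<theta> i = a + b * q ^ i + c * q powi (- int i)) \<and>
      (\<forall>i\<le>N. \<theta>s i = as + cs * q powi (- int i))) \<or>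
    \<comment> \<open>I-\<close>
    (b = 0 \<and> bs \<noteq> 0 \<and> c \<noteq> 0 \<and> cs \<noteq> 0 \<and>
      (\<forall>i<N. \<xi> i = x - q powi (- 1 - int N - int M - int i) * (q - 1)\<^sup>2 * c * cs) \<and>
      (\<forall>i\<le>N. \<theta> i = a + c * q powi (- int i)) \<and>
      (\<forall>i\<le>N. \<theta>s i = as + bs * q ^ i + cs * q powi (- int i))) \<or>
    \<comment> \<open>I0\<close>
    (b = 0 \<and> bs = 0 \<and> c \<noteq> 0 \<and> cs \<noteq> 0 \<and>
      (\<forall>i<N. \<xi> i = x - q powi (- 1 - int N - int M - int i) * (q - 1)\<^sup>2 * c * cs) \<and>
      (\<forall>i\<le>N. \<theta> i = a + c * q powi (- int i)) \<and>
      (\<forall>i\<le>N. \<theta>s i = as + cs * q powi (- int i))) \<or>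
    \<comment> \<open>II+\<close>
    (c \<noteq> 0 \<and> cs = 0 \<and> b \<noteq> 0 \<and> bs \<noteq> 0 \<and>
      (\<forall>i<N. \<xi> i = x - q powi (- 1 - int N - int M - int i) * (q - 1)\<^sup>2 * b * bs) \<and>
      (\<forall>i\<le>N. \<theta> i = a + b * q powi (- int i) + c * q ^ i) \<and>
      (\<forall>i\<le>N. \<theta>s i = as + bs * q powi (- int i))) \<or>
    \<comment> \<open>II-\<close>
    (c = 0 \<and> cs \<noteq> 0 \<and> b \<noteq> 0 \<and> bs \<noteq> 0 \<and>
      (\<forall>i<N. \<xi> i = x - q powi (- 1 - int N - int M - int i) * (q - 1)\<^sup>2 * b * bs) \<and>
      (\<forall>i\<le>N. \<theta> i = a + b * q powi (- int i)) \<and>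
      (\<forall>i\<le>N. \<theta>s i = as + bs * q powi (- int i) + cs * q ^ i)) \<or>
    \<comment> \<open>II0\<close>
    (c = 0 \<and> cs = 0 \<and> b \<noteq> 0 \<and> bs \<noteq> 0 \<and>
      (\<forall>i<N. \<xi> i = x - q powi (- 1 - int N - int M - int i) * (q - 1)\<^sup>2 * b * bs) \<and>
      (\<forall>i\<le>N. \<theta> i = a + b * q powi (- int i)) \<and>
      (\<forall>i\<le>N. \<theta>s i = as + bs * q powi (- int i))) \<or>
    \<comment> \<open>III+\<close>
    (x \<noteq> 0 \<and> b \<noteq> 0 \<and> bs = 0 \<and> c = 0 \<and> cs \<noteq> 0 \<and>
      (\<forall>i<N. \<xi> i = x) \<and>
      (\<forall>i\<le>N. \<theta> i = a + b * q ^ i) \<and>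
      (\<forall>i\<le>N. \<theta>s i = as + cs * q powi (- int i))) \<or>
    \<comment> \<open>III-\<close>
    (x \<noteq> 0 \<and> b = 0 \<and> bs \<noteq> 0 \<and> c \<noteq> 0 \<and> cs = 0 \<and>
      (\<forall>i<N. \<xi> i = x) \<and>
      (\<forall>i\<le>N. \<theta> i = a + c * q powi (- int i)) \<and>
      (\<forall>i\<le>N. \<theta>s i = as + bs * q ^ i))"
proof -
  interpret V: vector_space scale by fact
  obtain Basis where Basis: "V.independent Basis" "UNIV \<subseteq> V.span Basis" "card Basis = N + M"
    using V.basis_exists[of UNIV] \<open>V.dim UNIV = N + M\<close> by metis
  \<comment> \<open>Infinite sets have cardinality 0, so a positive cardinality gives
    finiteness.\<close>
  have "finite Basis" using Basis(3) \<open>N \<ge> 6\<close> by (intro card_ge_0_finite) simp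
  interpret H: attenuated scale Basis h N M
    by unfold_locales (use assms Basis \<open>finite Basis\<close> in auto)
  have Hq: "H.q = q" by (simp add: H.q_def q)
  interpret S: parameter_system "CARD('k)" N M q "\<beta> + 1" \<gamma> \<gamma>s \<theta> \<theta>s "\<lambda>i. \<alpha> i * \<alpha>s (i + 1)"
    unfolding Hq[symmetric]
    by (rule H.parameter_system_of_relations[OF assms(1,2) F assms(12-15)
          A[unfolded L R P] As[unfolded L R P] B[unfolded P] Bs[unfolded P]])
  obtain a b c as bs cs x where
    x: "\<forall>i<N. \<xi> i = x - q powi (- 1 - int N - int M - int i) * (q - 1)\<^sup>2 * c * cs"
    and t: "\<forall>i\<le>N. \<theta> i = a + b * q ^ i + c * q powi (- int i)"
    and ts: "\<forall>i\<le>N. \<theta>s i = as + bs * q ^ i + cs * q powi (- int i)"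
    and nz: "b * bs = 0" "b \<noteq> 0 \<or> c \<noteq> 0" "bs \<noteq> 0 \<or> cs \<noteq> 0" "c * cs = 0 \<longrightarrow> x \<noteq> 0"
    using S.parameter_forms \<xi> by metis
  \<comment> \<open>If \<open>c = 0\<close> then \<open>b\<close> is nonzero, so
    \<open>bs = 0\<close> and \<open>cs\<close> is nonzero; \<open>cs = 0\<close> is symmetric. In
    both situations the correction term in \<xi> vanishes.\<close>
  consider "c \<noteq> 0" "cs \<noteq> 0" "b \<noteq> 0" "bs = 0" | "c \<noteq> 0" "cs \<noteq> 0" "b = 0" "bs \<noteq> 0"
    | "c \<noteq> 0" "cs \<noteq> 0" "b = 0" "bs = 0" | "c = 0" "x \<noteq> 0" "b \<noteq> 0" "bs = 0" "cs \<noteq> 0"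
    | "c \<noteq> 0" "cs = 0" "x \<noteq> 0" "b = 0" "bs \<noteq> 0"
    using nz by auto
  then show ?thesis
    by cases (rule exI[of _ a], rule exI[of _ b], rule exI[of _ c], rule exI[of _ as],
        rule exI[of _ bs], rule exI[of _ cs], rule exI[of _ x], use x t ts in simp)+
qed

end
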